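(* For all positive integers $n,p$, $$\beta(n,p,4)=O\left(n^{3/4}p^{1/2}+n^{5/8}p^{11/16}+n+p\right).$$
   Context: A path system is a pair $S=(V,\Pi)$ where $V$ is a finite ground set of nodes and $\Pi$ is a multiset of finite sequences of nodes (paths), each path containing each node at most once. The size is $\|S\|=\sum_{\pi\in\Pi}|\pi|$, where $|\pi|$ is the number of nodes of $\pi$. Write $x<_\pi y$ if $x,y\in\pi$ and $x$ strictly precedes $y$ in $\pi$. A $b$-bridge consists of $b$ distinct nodes $v_1,\dots,v_b$ and $b$ distinct paths $\pi_1,\dots,\pi_b$ with $v_i<_{\pi_i}v_{i+1}$ for $1\le i\le b-1$ and $v_1<_{\pi_b}v_b$. The bridge girth of $S$ is the least $b$ for which $S$ has a $b$-bridge ($\infty$ if none). $\beta(n,p,k)$ is the maximum possible size of a path system with $n$ nodes, $p$ paths, and bridge girth $>k$. *)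

theory Defs
  imports Complex_Main "HOL-Library.Extended_Nat"
begin

text \<open>A path system: ground set V and a finite family of paths, given as a list
  (list positions distinguish repeated copies, so the list represents the multiset \<Pi>).
  Each path is a list of nodes of V without repetitions.\<close>
definition path_system :: "'a set \<Rightarrow> 'a list list \<Rightarrow> bool" where
  "path_system V Ps \<longleftrightarrow> finite V \<and> (\<forall>\<pi>\<in>set Ps. distinct \<pi> \<and> set \<pi> \<subseteq> V)"

definition ps_size :: "'a list list \<Rightarrow> nat" where
  "ps_size Ps = (\<Sum>\<pi>\<leftarrow>Ps. length \<pi>)"

definition precedes :: "'a list \<Rightarrow> 'a \<Rightarrow> 'a \<Rightarrow> bool" where
  "precedes \<pi> x y \<longleftrightarrow> (\<exists>i j. i < j \<and> j < length \<pi> \<and> \<pi> ! i = x \<and> \<pi> ! j = y)"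

definition has_bridge :: "'a list list \<Rightarrow> nat \<Rightarrow> bool" where
  "has_bridge Ps b \<longleftrightarrow> b \<ge> 1 \<and> (\<exists>(v::nat \<Rightarrow> 'a) (f::nat \<Rightarrow> nat).
      inj_on v {0..<b} \<and> inj_on f {0..<b} \<and> (\<forall>i<b. f i < length Ps) \<and>
      (\<forall>i. i + 1 < b \<longrightarrow> precedes (Ps ! f i) (v i) (v (i+1))) \<and>
      precedes (Ps ! f (b - 1)) (v 0) (v (b - 1)))"

definition bridge_girth :: "'a list list \<Rightarrow> enat" where
  "bridge_girth Ps = (if \<exists>b. has_bridge Ps b then enat (LEAST b. has_bridge Ps b) else \<infinity>)"

text \<open>beta n p k: maximum size of a path system with n nodes, p paths and bridge girth > k
  (nodes taken from nat w.l.o.g.; the set of sizes is finite, bounded by n*p).\<close>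
definition beta :: "nat \<Rightarrow> nat \<Rightarrow> nat \<Rightarrow> nat" where
  "beta n p k = Max {ps_size Ps | (V::nat set) Ps. path_system V Ps \<and> card V = n \<and>
       length Ps = p \<and> bridge_girth Ps > enat k}"

end

theory Submission
  imports Defs "HOL-Analysis.Convex"
begin

text \<open>
  Let \<open>d\<close> and \<open>\<ell>\<close> be the average degree and path length. For two paths \<open>P\<close>, \<open>Q\<close>, the paths leading from
  \<open>P\<close> to \<open>Q\<close> (rungs) hit \<open>P\<close> and \<open>Q\<close> in the same order, since two crossing rungs form a 4-bridge with
  \<open>P\<close> and \<open>Q\<close>. Hence nearby rungs of length about \<open>\<ell>\<close> span many thin diamonds: a walk (short step, long
  step) and a walk (long step, short step) with the same ends \<open>(u, v)\<close>. By Cauchy-Schwarz there are then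
  many pairs of (short, long) walks with common ends, or many pairs of (long, short) ones. Two such
  walks are again rungs of a ladder, now with two ends close together on one path and the other two far
  apart on the other, and monotonicity of ladders allows only few of these. Comparing both counts gives
  \<open>size\<^sup>4 = O(n\<^sup>3p\<^sup>2)\<close> or \<open>size\<^sup>1\<^sup>0 = O(n\<^sup>6p\<^sup>7)\<close> unless \<open>size = O(n + p)\<close>.

  Two paths may meet repeatedly, in opposite orders. After halving every path, 4-bridges bound the number
  of such multiple crossings by a constant per node of a path on average, so single crossings dominate.
\<close>

section \<open>Counting\<close>

lemma card_le1I: "(\<And>a b. a \<in> A \<Longrightarrow> b \<in> A \<Longrightarrow> a = b) \<Longrightarrow> card A \<le> 1"
  by (metis One_nat_def card.infinite card_le_Suc0_iff_eq le0)

lemma card_Sigma_le: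
  assumes "finite A" "\<And>x. x \<in> A \<Longrightarrow> finite (B x)" "\<And>x. x \<in> A \<Longrightarrow> card (B x) \<le> c"
  shows "card (Sigma A B) \<le> card A * c"
proof -
  have "card (Sigma A B) = (\<Sum>x\<in>A. card (B x))"
    using assms by simp
  also have "\<dots> \<le> (\<Sum>x\<in>A. c)"
    using assms by (intro sum_mono) auto
  finally show ?thesis
    by simp
qed

lemma card_equal_key_pairs:
  assumes "finite A" "finite B" "finite T" "f ` A \<subseteq> T"
  shows "card {(x, y) \<in> A \<times> B. f x = g y} = (\<Sum>t\<in>T. card {x\<in>A. f x = t} * card {y\<in>B. g y = t})"
proof -
  have "{(x, y) \<in> A \<times> B. f x = g y} = (\<Union>t\<in>T. {x\<in>A. f x = t} \<times> {y\<in>B. g y = t})"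
    using assms by auto
  moreover have "card \<dots> = (\<Sum>t\<in>T. card ({x\<in>A. f x = t} \<times> {y\<in>B. g y = t}))"
    using assms by (intro card_UN_disjoint) auto
  ultimately show ?thesis
    by (simp add: card_cartesian_product)
qed

text \<open>Cauchy-Schwarz over the fibres of \<open>f\<close>: their sizes sum to
  \<open>card A\<close>, and the squares of their sizes count the pairs with equal key.\<close>

lemma card_squared_le_key_pairs:
  assumes "finite A" "finite T" "f ` A \<subseteq> T"
  shows "(card A)\<^sup>2 \<le> card T * card {(x, y) \<in> A \<times> A. f x = f y}"
proof -
  let ?c = "\<lambda>t. card {x\<in>A. f x = t}"
  have "card A = (\<Sum>t\<in>T. ?c t)"
    using sum.group[OF assms, of "\<lambda>_. 1::nat"] by simp
  then have "(real (card A))\<^sup>2 = (\<Sum>t\<in>T. real (?c t))\<^sup>2"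
    by simp
  also have "\<dots> \<le> (\<Sum>t\<in>T. (real (?c t))\<^sup>2) * card T"
    using sum_squared_le_sum_of_squares by blast
  also have "\<dots> = real (card T * card {(x, y) \<in> A \<times> A. f x = f y})"
    by (subst card_equal_key_pairs[OF assms(1,1,2,3)]) (simp add: power2_eq_square mult.commute)
  finally show ?thesis
    by (simp only: of_nat_power[symmetric] of_nat_le_iff)
qed

text \<open>Fibres of sizes a and b over the same key satisfy 2ab \<le> a^2 + b^2. This transfers
  bounds on pairs of walks of one type to pairs made of two different types.\<close>

lemma card_mixed_key_pairs_le:
  assumes "finite A" "finite B"
  shows "2 * card {(x, y) \<in> A \<times> B. f x = g y} \<le>
    card {(x, y) \<in> A \<times> A. f x = f y} + card {(x, y) \<in> B \<times> B. g x = g y}"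
proof -
  let ?T = "f ` A \<union> g ` B"
  have amgm: "2 * (a * b) \<le> a * a + b * b" for a b :: nat
  proof -
    have "real (2 * (a * b)) \<le> real (a * a + b * b)"
      using sum_squares_bound[of "real a" "real b"] by (simp add: power2_eq_square)
    then show ?thesis by (simp only: of_nat_le_iff)
  qed
  have T: "finite ?T" "f ` A \<subseteq> ?T" "g ` B \<subseteq> ?T"
    using assms by auto
  show ?thesis
    unfolding card_equal_key_pairs[OF assms T(1,2)] card_equal_key_pairs[OF assms(1,1) T(1,2)]
      card_equal_key_pairs[OF assms(2,2) T(1,3)] sum_distrib_left sum.distrib[symmetric]
    by (intro sum_mono amgm)
qed

text \<open>Classes of size \<open>d\<close> are split off as long as more than \<open>2 * d\<close>
  elements are present. The rest then always keeps at least \<open>d\<close> elements and finally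
  becomes a class itself.\<close>

lemma balanced_partition:
  fixes d :: nat
  assumes "finite S" "0 < d" "d \<le> card S"
  shows "\<exists>f::'b \<Rightarrow> nat. \<forall>x\<in>S. d \<le> card {y\<in>S. f y = f x} \<and> card {y\<in>S. f y = f x} \<le> 2 * d"
  using assms
proof (induction "card S" arbitrary: S rule: less_induct)
  case less
  show ?case
  proof (cases "card S \<le> 2 * d")
    case True
    then show ?thesis
      using less.prems by (intro exI[of _ "\<lambda>_. 0"]) auto
  next
    case False
    obtain D where D: "D \<subseteq> S" "card D = d" "finite D"
      using less.prems by (meson obtain_subset_with_card_n)
    have cSD: "card (S - D) = card S - d"
      using D by (simp add: card_Diff_subset)
    have "card (S - D) < card S" "finite (S - D)" "d \<le> card (S - D)"
      using cSD less.prems False by auto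
    then obtain f :: "'b \<Rightarrow> nat"
      where f: "\<forall>x\<in>S-D. d \<le> card {y\<in>S-D. f y = f x} \<and> card {y\<in>S-D. f y = f x} \<le> 2 * d"
      using less.hyps[of "S - D"] less.prems by blast
    define h where "h = (\<lambda>y. if y \<in> D then 0 else Suc (f y))"
    have "{y\<in>S. h y = h x} = D" if "x \<in> D" for x
      using that D by (auto simp: h_def)
    moreover have "{y\<in>S. h y = h x} = {y\<in>S-D. f y = f x}" if "x \<in> S - D" for x
      using that D by (auto simp: h_def)
    ultimately have "d \<le> card {y\<in>S. h y = h x} \<and> card {y\<in>S. h y = h x} \<le> 2 * d" if "x \<in> S" for x
      using f D(2) that by (cases "x \<in> D") auto
    then show ?thesis by blast
  qed
qed

text \<open>The second coordinates of such a pair are separated by a multiple of \<open>L\<close>, and by monotonicity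
  each multiple of \<open>L\<close> can be crossed by pairs from only one cell of length \<open>s\<close>.\<close>

lemma skew_pairs_of_chain:
  fixes C :: "(nat \<times> nat) set" and s L :: nat
  assumes chain: "\<And>x y x' y'. (x, y) \<in> C \<Longrightarrow> (x', y') \<in> C \<Longrightarrow> x < x' \<longleftrightarrow> y < y'"
    and bound: "\<And>x y. (x, y) \<in> C \<Longrightarrow> y < m" and "0 < s" "0 < L"
  defines "Z \<equiv> {(c, c') \<in> C \<times> C. fst c < fst c' \<and> fst c div s = fst c' div s \<and> snd c + L \<le> snd c'}"
  shows "finite Z" "card Z \<le> s\<^sup>2 * (m div L)"
proof -
  \<comment> \<open>\<open>h\<close> keeps the last multiple of \<open>L\<close> up to the upper
    second coordinate and the two offsets inside the cell of length \<open>s\<close>. The cell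
    itself is recovered from monotonicity.\<close>
  define h :: "(nat \<times> nat) \<times> (nat \<times> nat) \<Rightarrow> nat \<times> nat \<times> nat"
    where "h = (\<lambda>(c, c'). (snd c' div L, fst c mod s, fst c' mod s))"
  let ?R = "{1..m div L} \<times> {..<s} \<times> {..<s}"
  have mono: "fst c < fst c' \<longleftrightarrow> snd c < snd c'" if "c \<in> C" "c' \<in> C" for c c'
    using chain[of "fst c" "snd c" "fst c'" "snd c'"] that by simp
  have eq: "c = c'" if "c \<in> C" "c' \<in> C" "fst c = fst c'" for c c'
  proof -
    have "\<not> snd c < snd c'" "\<not> snd c' < snd c"
      using that mono[of c c'] mono[of c' c] by auto
    then show ?thesis
      using that(3) by (simp add: prod_eq_iff)
  qed
  have barrier: "snd c < (snd c' div L) * L" "(snd c' div L) * L \<le> snd c'" if "(c, c') \<in> Z" for c c'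
  proof -
    have "snd c' < (snd c' div L) * L + L"
      using assms(4) by (metis add.commute dividend_less_div_times)
    then show "snd c < (snd c' div L) * L"
      using that unfolding Z_def by auto
  qed auto
  \<comment> \<open>If the cell of c lies below that of e, then c' precedes e in the first
    coordinate and hence in the second. But the common multiple of \<open>L\<close> is at most
    \<open>snd c'\<close> and exceeds \<open>snd e\<close>.\<close>
  have no_two_cells: False
    if "(c, c') \<in> Z" "(e, e') \<in> Z" "snd c' div L = snd e' div L" "fst c div s < fst e div s" for c c' e e'
  proof -
    have "fst c' < fst e"
      using that(1,4) div_le_mono[of "fst e" "fst c'" s] unfolding Z_def by fastforce
    then have "snd c' < snd e"
      using mono[of c' e] that(1,2) unfolding Z_def by auto
    then show False
      using barrier[OF that(1)] barrier[OF that(2)] that(3) by simp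
  qed
  have inj: "inj_on h Z"
  proof (rule inj_onI)
    fix z z' assume z: "z \<in> Z" "z' \<in> Z" "h z = h z'"
    obtain c c' e e' where ce: "z = (c, c')" "z' = (e, e')"
      by (metis surj_pair)
    have m: "snd c' div L = snd e' div L" "fst c mod s = fst e mod s" "fst c' mod s = fst e' mod s"
      using z(3) unfolding ce h_def by auto
    have d: "fst c div s = fst e div s"
      using no_two_cells[of c c' e e'] no_two_cells[of e e' c c'] z m unfolding ce
      by (metis linorder_neqE_nat)
    have "fst c = fst e"
      using d m by (metis div_mult_mod_eq)
    moreover have "fst c' = fst e'"
    proof -
      have "fst c' div s = fst e' div s"
        using d z(1,2) unfolding ce Z_def by auto
      then show ?thesis
        using m(3) by (metis div_mult_mod_eq)
    qed
    ultimately show "z = z'"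
      using eq z(1,2) unfolding ce Z_def by blast
  qed
  have sub: "h ` Z \<subseteq> ?R"
  proof
    fix q assume "q \<in> h ` Z"
    then obtain c c' where c: "(c, c') \<in> Z" "q = h (c, c')"
      by auto
    have "snd c' < m" "L \<le> snd c'"
      using c(1) bound[of "fst c'" "snd c'"] unfolding Z_def by auto
    then have "snd c' div L \<le> m div L" "1 \<le> snd c' div L"
      using assms(4) by (auto simp: div_le_mono div_greater_zero_iff Suc_le_eq)
    then show "q \<in> ?R"
      using assms(3) unfolding c(2) h_def by auto
  qed
  show "finite Z"
    using inj_on_finite[OF inj sub] by simp
  have "card Z \<le> card ?R"
    using sub inj by (intro card_inj_on_le) auto
  then show "card Z \<le> s\<^sup>2 * (m div L)"
    by (simp add: card_cartesian_product power2_eq_square mult.commute)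
qed

section \<open>Families of paths without short bridges\<close>

definition before :: "('i \<Rightarrow> 'a set) \<Rightarrow> ('i \<Rightarrow> 'a \<Rightarrow> nat) \<Rightarrow> 'i \<Rightarrow> 'a \<Rightarrow> 'a \<Rightarrow> bool" where
  "before N pos i x y \<longleftrightarrow> x \<in> N i \<and> y \<in> N i \<and> pos i x < pos i y"

text \<open>Indices keep equal paths apart, and separate position functions make it easy to pass to
  sub-paths. \<open>no4\<close> speaks of distinct paths only: if the paths are distinct, coinciding
  nodes would already yield a 2-bridge.\<close>

locale bridge_free_family =
  fixes I :: "'i set" and N :: "'i \<Rightarrow> 'a set" and pos :: "'i \<Rightarrow> 'a \<Rightarrow> nat"
  assumes finite_I: "finite I"
    and finite_N: "i \<in> I \<Longrightarrow> finite (N i)"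
    and pos_bij: "i \<in> I \<Longrightarrow> bij_betw (pos i) (N i) {..<card (N i)}"
    and no2: "\<lbrakk>i \<in> I; j \<in> I; before N pos i x y; before N pos j x y\<rbrakk> \<Longrightarrow> i = j"
    and no3: "\<lbrakk>i \<in> I; j \<in> I; k \<in> I; before N pos i x y; before N pos j y z; before N pos k x z\<rbrakk>
      \<Longrightarrow> \<not> distinct [i, j, k]"
    and no4: "\<lbrakk>i \<in> I; j \<in> I; k \<in> I; l \<in> I; before N pos i x y; before N pos j y z;
      before N pos k z w; before N pos l x w\<rbrakk> \<Longrightarrow> \<not> distinct [i, j, k, l]"
begin

abbreviation "lt \<equiv> before N pos"

lemma pos_inj: "i \<in> I \<Longrightarrow> inj_on (pos i) (N i)"
  using pos_bij bij_betw_def by blast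

lemma pos_eqD: "i \<in> I \<Longrightarrow> x \<in> N i \<Longrightarrow> y \<in> N i \<Longrightarrow> pos i x = pos i y \<Longrightarrow> x = y"
  using pos_inj by (meson inj_onD)

lemma pos_less: "i \<in> I \<Longrightarrow> x \<in> N i \<Longrightarrow> pos i x < card (N i)"
  using pos_bij bij_betwE by blast

lemma lt_total: "i \<in> I \<Longrightarrow> x \<in> N i \<Longrightarrow> y \<in> N i \<Longrightarrow> x \<noteq> y \<Longrightarrow> lt i x y \<or> lt i y x"
  unfolding before_def using pos_eqD by (metis linorder_neqE_nat)

text \<open>Two paths visiting two common nodes in the same order form a 2-bridge.\<close>

lemma lt_flip:
  assumes "i \<in> I" "j \<in> I" "i \<noteq> j" "lt i x y" "x \<in> N j" "y \<in> N j"
  shows "lt j y x"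
  using assms lt_total[of j x y] no2[of i j x y] by (auto simp: before_def)

lemma rank_order:
  assumes "i \<in> I" "T \<subseteq> N i" "x \<in> T" "y \<in> T"
  shows "card {z\<in>T. pos i z < pos i x} < card {z\<in>T. pos i z < pos i y} \<longleftrightarrow> pos i x < pos i y"
proof -
  have fin: "finite T"
    using assms finite_N finite_subset by blast
  have lt: "card {z\<in>T. pos i z < pos i x} < card {z\<in>T. pos i z < pos i y}"
    if "x \<in> T" "pos i x < pos i y" for x y
    using that fin by (intro psubset_card_mono) auto
  consider "pos i x < pos i y" | "x = y" | "pos i y < pos i x"
    using pos_eqD[of i x y] assms by fastforce
  then show ?thesis
    using lt[of x y] lt[of y x] assms by cases auto
qed

text \<open>Deleting paths and nodes creates no bridge. Ranking the surviving nodes makes positions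
  consecutive again, as \<open>pos_bij\<close> demands.\<close>

lemma restrict:
  assumes J: "J \<subseteq> I" and T: "\<And>i. i \<in> J \<Longrightarrow> T i \<subseteq> N i"
  defines "rk \<equiv> \<lambda>i x. card {z\<in>T i. pos i z < pos i x}"
  shows "bridge_free_family J T rk"
    and "\<And>i x y. i \<in> J \<Longrightarrow> x \<in> T i \<Longrightarrow> y \<in> T i \<Longrightarrow> rk i x < rk i y \<longleftrightarrow> pos i x < pos i y"
proof -
  have fin: "finite (T i)" if "i \<in> J" for i
    using finite_subset[OF T[OF that] finite_N] that J by blast
  show rk: "rk i x < rk i y \<longleftrightarrow> pos i x < pos i y" if "i \<in> J" "x \<in> T i" "y \<in> T i" for i x y
    unfolding rk_def using rank_order[of i "T i" x y] that J T by blast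
  have lt: "lt i x y" if "before T rk i x y" "i \<in> J" for i x y
    using that rk[of i x y] T[of i] unfolding before_def by auto
  show "bridge_free_family J T rk"
  proof
    show "finite J" using finite_subset[OF J finite_I] .
    show "finite (T i)" if "i \<in> J" for i using that fin by blast
    show "bij_betw (rk i) (T i) {..<card (T i)}" if i: "i \<in> J" for i
    proof -
      have "inj_on (rk i) (T i)"
      proof (rule inj_onI)
        fix x y assume xy: "x \<in> T i" "y \<in> T i" "rk i x = rk i y"
        then have "pos i x = pos i y"
          using rk[OF i, of x y] rk[OF i, of y x] by auto
        then show "x = y"
          using pos_eqD[of i x y] xy i J T[OF i] by auto
      qed
      moreover have "rk i ` T i \<subseteq> {..<card (T i)}"
        unfolding rk_def using fin[OF i] by (auto intro!: psubset_card_mono)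
      ultimately show ?thesis
        by (simp add: bij_betw_def card_image card_subset_eq)
    qed
    fix i j x y assume *: "i \<in> J" "j \<in> J" "before T rk i x y" "before T rk j x y"
    show "i = j"
      using no2[OF _ _ lt[OF *(3,1)] lt[OF *(4,2)]] * J by blast
  next
    fix i j k x y z
    assume *: "i \<in> J" "j \<in> J" "k \<in> J" "before T rk i x y" "before T rk j y z" "before T rk k x z"
    show "\<not> distinct [i, j, k]"
      using no3[OF _ _ _ lt[OF *(4,1)] lt[OF *(5,2)] lt[OF *(6,3)]] * J by blast
  next
    fix i j k l x y z w
    assume *: "i \<in> J" "j \<in> J" "k \<in> J" "l \<in> J" "before T rk i x y" "before T rk j y z"
      "before T rk k z w" "before T rk l x w"
    show "\<not> distinct [i, j, k, l]"
      using no4[OF _ _ _ _ lt[OF *(5,1)] lt[OF *(6,2)] lt[OF *(7,3)] lt[OF *(8,4)]] * J by blast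
  qed
qed

text \<open>By \<open>lt_flip\<close> these paths visit \<open>x\<close> and the earlier node in the opposite order.\<close>

definition "dn T i x = {j\<in>I. j \<noteq> i \<and> x \<in> N j \<and> (\<exists>y\<in>T \<inter> N j. pos i y < pos i x)}"

text \<open>Let k reverse y with a lower node z. The steps x to y on j, y to z on k, z to w on i,
  closed by l from x to w, would form a 4-bridge, so k is j or l. If k = l, then l visits x before y
  just as j does, which is a 2-bridge.\<close>

lemma dn_lower:
  assumes i: "i \<in> I" and x: "x \<in> N i" and jl: "j \<in> dn (N i) i x" "l \<in> dn (N i) i x" "j \<noteq> l"
    and w: "w \<in> N i" "w \<in> N l" "pos i w < pos i x" and y: "y \<in> N i" "y \<in> N j" "pos i y < pos i w"
  shows "dn (N i) i y \<subseteq> {j}"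
proof
  fix k assume k: "k \<in> dn (N i) i y"
  obtain z where z: "z \<in> N i" "z \<in> N k" "pos i z < pos i y"
    using k by (auto simp: dn_def)
  have I: "j \<in> I" "k \<in> I" "l \<in> I" "j \<noteq> i" "k \<noteq> i" "l \<noteq> i" and mem: "x \<in> N j" "x \<in> N l" "y \<in> N k"
    using jl k by (auto simp: dn_def)
  have s1: "lt j x y" "lt l x w" "lt k y z"
    using lt_flip[of i j y x] lt_flip[of i l w x] lt_flip[of i k z y] i x w y z I mem
    by (auto simp: before_def)
  have s2: "lt i z w"
    using z y w by (auto simp: before_def)
  have "k = j \<or> k = l"
    using no4[OF I(1,2) i I(3) s1(1,3) s2 s1(2)] I jl by auto
  moreover have "k \<noteq> l"
  proof
    assume "k = l"
    then have "lt l x y"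
      using lt_flip[of i l y x] i x y w I mem by (auto simp: before_def)
    then show False
      using no2[OF I(1,3) s1(1)] jl(3) by blast
  qed
  ultimately show "k \<in> {j}" by blast
qed

text \<open>The nodes with two or more reversals below them have, up to one path, only partners with at most
  one reversal (\<open>dn_lower\<close>), so both these nodes and the remaining ones form an admissible set.\<close>

lemma exists_half_with_few_reversals:
  assumes i: "i \<in> I"
  shows "\<exists>T\<subseteq>N i. card (N i) \<le> 2 * card T \<and> (\<forall>x\<in>T. card (dn T i x) \<le> 1)"
proof -
  define Top where "Top = {x\<in>N i. 2 \<le> card (dn (N i) i x)}"
  have fin: "finite (N i)" "finite (dn (N i) i x)" for x
    using finite_N i finite_I by (auto simp: dn_def)
  have sub: "dn T i x \<subseteq> dn (N i) i x" if "T \<subseteq> N i" for T x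
    using that by (auto simp: dn_def)
  have bot: "card (dn (N i - Top) i x) \<le> 1" if "x \<in> N i - Top" for x
  proof -
    have "card (dn (N i - Top) i x) \<le> card (dn (N i) i x)"
      using sub[of "N i - Top"] fin by (intro card_mono) auto
    then show ?thesis
      using that by (auto simp: Top_def)
  qed
  have top: "card (dn Top i x) \<le> 1" if x: "x \<in> Top" for x
  proof -
    \<comment> \<open>Let w be the highest node of \<open>U\<close> and l a path through x and w. If
      another path j joined x to a lower node y of \<open>Top\<close>, then y would lie below w, and
      \<open>dn_lower\<close> would leave y at most one reversal, contrary to the choice of
      \<open>Top\<close>.\<close>
    define U where "U = {y\<in>N i. pos i y < pos i x \<and> (\<exists>j\<in>dn (N i) i x. y \<in> N j)}"
    have xN: "x \<in> N i"
      using x by (auto simp: Top_def)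
    have "dn (N i) i x \<noteq> {}"
      using x by (auto simp: Top_def)
    then have U: "finite U" "U \<noteq> {}"
      using fin unfolding U_def dn_def by auto
    then have "Max (pos i ` U) \<in> pos i ` U"
      by simp
    then obtain w where w: "w \<in> U" "Max (pos i ` U) = pos i w"
      by auto
    then have w2: "\<forall>y\<in>U. pos i y \<le> pos i w"
      using U(1) by (metis Max_ge finite_imageI image_eqI)
    obtain l where l: "l \<in> dn (N i) i x" "w \<in> N l" and w': "w \<in> N i" "pos i w < pos i x"
      using w(1) by (auto simp: U_def)
    have "j = l" if j: "j \<in> dn Top i x" for j
    proof (rule ccontr)
      assume "j \<noteq> l"
      obtain y where y: "y \<in> Top" "y \<in> N j" "pos i y < pos i x"
        using j by (auto simp: dn_def)
      have yN: "y \<in> N i" using y by (auto simp: Top_def)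
      have jd: "j \<in> dn (N i) i x"
        using j sub[of Top x] by (auto simp: Top_def)
      have "y \<in> U"
        using y yN jd by (auto simp: U_def)
      moreover have "y \<noteq> w"
      proof
        assume "y = w"
        then have "lt j x w" "lt l x w"
          using lt_flip[of i j w x] lt_flip[of i l w x] i xN w' jd l y by (auto simp: before_def dn_def)
        then show False
          using no2[of j l x w] jd l \<open>j \<noteq> l\<close> by (auto simp: dn_def)
      qed
      ultimately have "pos i y < pos i w"
        using w2 pos_eqD[OF i yN w'(1)] by fastforce
      then have "dn (N i) i y \<subseteq> {j}"
        using dn_lower[OF i xN jd l(1) \<open>j \<noteq> l\<close> w'(1) l(2) w'(2) yN y(2)] by blast
      then have "card (dn (N i) i y) \<le> card {j}"
        by (intro card_mono) auto
      then show False
        using y(1) by (auto simp: Top_def)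
    qed
    then show ?thesis
      by (intro card_le1I) blast
  qed
  have "card (N i) = card Top + card (N i - Top)"
    using fin(1) card_Int_Diff[of "N i" Top] by (simp add: Top_def Int_def conj_ac cong: conj_cong)
  then have "card (N i) \<le> 2 * card Top \<or> card (N i) \<le> 2 * card (N i - Top)"
    by linarith
  moreover have "Top \<subseteq> N i"
    by (auto simp: Top_def)
  ultimately show ?thesis
    using top bot by blast
qed

end

section \<open>Multiple crossings\<close>

context bridge_free_family
begin

definition "multi i x = {j\<in>I. j \<noteq> i \<and> x \<in> N j \<and> N i \<inter> N j \<noteq> {x}}"

text \<open>Double counting over the other paths j. If j meets i in b \<ge> 2 nodes, all b are
  multiple crossings, while all but the lowest, b - 1 \<ge> b/2 of them, see j in \<open>dn\<close>.
  By \<open>few\<close> the latter incidences number at most one per node.\<close>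

lemma sum_multi_le:
  assumes i: "i \<in> I" and few: "\<And>x. x \<in> N i \<Longrightarrow> card (dn (N i) i x) \<le> 1"
  shows "(\<Sum>x\<in>N i. card (multi i x)) \<le> 2 * card (N i)"
proof -
  define low where "low j = {x\<in>N i. j \<noteq> i \<and> x \<in> N j \<and> (\<exists>y\<in>N i \<inter> N j. pos i y < pos i x)}" for j
  define mul where "mul j = {x\<in>N i. j \<noteq> i \<and> x \<in> N j \<and> N i \<inter> N j \<noteq> {x}}" for j
  have fin: "finite (N i)" using finite_N i .
  have mul_low: "card (mul j) \<le> 2 * card (low j)" if "j \<in> I" for j
  proof (cases "mul j = {}")
    case False
    then have "j \<noteq> i" by (auto simp: mul_def)
    let ?B = "N i \<inter> N j"
    have B: "finite ?B" "mul j \<subseteq> ?B" "?B \<noteq> {}" "mul j \<noteq> {}"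
      using fin False by (auto simp: mul_def)
    then have "Min (pos i ` ?B) \<in> pos i ` ?B"
      by simp
    then obtain m where m: "m \<in> ?B" "Min (pos i ` ?B) = pos i m"
      by auto
    have m2: "pos i m \<le> pos i y" if "y \<in> ?B" for y
      using B(1) m that by (metis Min_le finite_imageI image_eqI)
    have "?B - {m} \<subseteq> low j"
    proof
      fix x assume x: "x \<in> ?B - {m}"
      then have "pos i m < pos i x"
        using m2[of x] pos_eqD[OF i, of x m] m by fastforce
      then show "x \<in> low j"
        using x m \<open>j \<noteq> i\<close> by (auto simp: low_def)
    qed
    then have "card (?B - {m}) \<le> card (low j)"
      using fin by (intro card_mono) (auto simp: low_def)
    then have le: "card ?B \<le> Suc (card (low j))"
      using m(1) B(1) by simp
    obtain x where "x \<in> ?B" "?B \<noteq> {x}"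
      using False by (auto simp: mul_def)
    then have "card ?B \<noteq> 1"
      by (metis card_1_singletonE singletonD)
    moreover have "card ?B \<noteq> 0"
      using B by simp
    moreover have "card (mul j) \<le> card ?B"
      using B by (intro card_mono)
    ultimately show ?thesis
      using le by linarith
  qed simp
  have "(\<Sum>x\<in>N i. card (multi i x)) = (\<Sum>j\<in>I. card (mul j))"
    unfolding multi_def mul_def
    by (rule sum_multicount_gen[OF fin finite_I]) simp
  also have "\<dots> \<le> (\<Sum>j\<in>I. 2 * card (low j))"
    by (intro sum_mono mul_low)
  also have "\<dots> = 2 * (\<Sum>x\<in>N i. card (dn (N i) i x))"
    unfolding dn_def low_def sum_distrib_left[symmetric]
    by (subst sum_multicount_gen[OF fin finite_I]) simp_all
  also have "(\<Sum>x\<in>N i. card (dn (N i) i x)) \<le> (\<Sum>x\<in>N i. 1)"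
    by (intro sum_mono few)
  finally show ?thesis by simp
qed

section \<open>Ladders\<close>

text \<open>A rung, that is a third path leading from \<open>i\<close> to \<open>k\<close>, is recorded by its two ends; they
  determine it because there are no 2-bridges.\<close>

definition "ladder i k = {(x, y). i \<noteq> k \<and> (\<exists>j\<in>I. j \<noteq> i \<and> j \<noteq> k \<and> N i \<inter> N j = {x} \<and> N j \<inter> N k = {y} \<and> lt j x y)}"

lemma ladderI:
  "\<lbrakk>i \<noteq> k; j \<in> I; j \<noteq> i; j \<noteq> k; N i \<inter> N j = {x}; N j \<inter> N k = {y}; lt j x y\<rbrakk> \<Longrightarrow> (x, y) \<in> ladder i k"
  unfolding ladder_def by blast

text \<open>Let x precede x' on i. If y = y', the nodes x, x', y form a 3-bridge on i, j', j. If y'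
  precedes y on k, the nodes x, x', y', y form a 4-bridge on i, j', k, closed by j. Rungs with a
  common start and different ends form a 3-bridge with k.\<close>

lemma ladder_mono:
  assumes ik: "i \<in> I" "k \<in> I" and mem: "(x, y) \<in> ladder i k" "(x', y') \<in> ladder i k"
  shows "pos i x < pos i x' \<longleftrightarrow> pos k y < pos k y'"
proof -
  have key: "pos k y < pos k y'" if mem: "(x, y) \<in> ladder i k" "(x', y') \<in> ladder i k"
    and less: "pos i x < pos i x'" for x y x' y'
  proof -
    obtain j j' where j: "j \<in> I" "j \<noteq> i" "j \<noteq> k" "N i \<inter> N j = {x}" "N j \<inter> N k = {y}" "lt j x y"
      and j': "j' \<in> I" "j' \<noteq> i" "j' \<noteq> k" "N i \<inter> N j' = {x'}" "N j' \<inter> N k = {y'}" "lt j' x' y'"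
      and "i \<noteq> k"
      using mem unfolding ladder_def by blast
    have "j \<noteq> j'"
      using j(4) j'(4) less by force
    have xx: "lt i x x'"
      using less j j' by (auto simp: before_def)
    have "y \<noteq> y'"
      using no3[OF ik(1) j'(1) j(1) xx] j j' \<open>j \<noteq> j'\<close> by auto
    moreover have "\<not> lt k y' y"
      using no4[OF ik(1) j'(1) ik(2) j(1) xx j'(6) _ j(6)] j j' \<open>j \<noteq> j'\<close> \<open>i \<noteq> k\<close> by auto
    ultimately have "lt k y y'"
      using lt_total[OF ik(2), of y y'] j j' by auto
    then show ?thesis by (simp add: before_def)
  qed
  have eq: "y = y'" if same: "pos i x = pos i x'"
  proof (rule ccontr)
    assume "y \<noteq> y'"
    obtain j j' where j: "j \<in> I" "j \<noteq> i" "j \<noteq> k" "N i \<inter> N j = {x}" "N j \<inter> N k = {y}" "lt j x y"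
      and j': "j' \<in> I" "j' \<noteq> i" "j' \<noteq> k" "N i \<inter> N j' = {x'}" "N j' \<inter> N k = {y'}" "lt j' x' y'"
      using mem unfolding ladder_def by blast
    have "x = x'"
      using pos_eqD[OF ik(1) _ _ same] j j' by auto
    have "j \<noteq> j'"
      using j(5) j'(5) \<open>y \<noteq> y'\<close> by force
    have "lt k y y' \<or> lt k y' y"
      using lt_total[OF ik(2), of y y'] j j' \<open>y \<noteq> y'\<close> by auto
    then show False
      using no3[OF j(1) ik(2) j'(1) j(6)] no3[OF j'(1) ik(2) j(1) j'(6)] j j' \<open>j \<noteq> j'\<close> \<open>x = x'\<close> by auto
  qed
  show ?thesis
    using key[OF mem] key[OF mem(2,1)] eq by (metis linorder_neqE_nat order_less_asym less_irrefl)
qed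

lemma ladder_mem: "(x, y) \<in> ladder i k \<Longrightarrow> x \<in> N i \<and> y \<in> N k"
  unfolding ladder_def by auto

lemma finite_ladder: "i \<in> I \<Longrightarrow> k \<in> I \<Longrightarrow> finite (ladder i k)"
  using ladder_mem finite_N by (auto intro!: finite_subset[of "ladder i k" "N i \<times> N k"])

end

section \<open>Pairs of two-step walks with common ends\<close>

text \<open>The labels \<open>g\<close> split every node virtually into nodes of degree between \<open>d\<close> and \<open>2 * d\<close>.\<close>

locale dense_family = bridge_free_family I N pos
  for I :: "'i set" and N :: "'i \<Rightarrow> 'a set" and pos +
  fixes g :: "'a \<Rightarrow> 'i \<Rightarrow> nat" and d :: nat
  assumes multi_le: "i \<in> I \<Longrightarrow> (\<Sum>x\<in>N i. card (multi i x)) \<le> 2 * card (N i)"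
    and group_ge: "\<lbrakk>i \<in> I; x \<in> N i\<rbrakk> \<Longrightarrow> d \<le> card {j\<in>I. x \<in> N j \<and> g x j = g x i}"
    and group_le: "\<lbrakk>i \<in> I; x \<in> N i\<rbrakk> \<Longrightarrow> card {j\<in>I. x \<in> N j \<and> g x j = g x i} \<le> 2 * d"
begin

text \<open>Equal labels leave at most \<open>2 * d\<close> choices for the next path; the single
  crossing is what allows the paths of a walk to serve as rungs of a ladder.\<close>

definition "corner a i j \<longleftrightarrow> i \<in> I \<and> j \<in> I \<and> i \<noteq> j \<and> N i \<inter> N j = {a} \<and> g a i = g a j"

definition "M = (\<Sum>i\<in>I. card (N i))"

definition "Inc = (SIGMA i:I. N i)"

definition "Mul = (SIGMA q:Inc. multi (fst q) (snd q))"

definition "walks F G = {(u, i, a, j, v). corner a i j \<and> F i u a \<and> G j a v}"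

definition ends :: "'a \<times> 'i \<times> 'a \<times> 'i \<times> 'a \<Rightarrow> 'a \<times> 'a" where
  "ends = (\<lambda>(u, i, a, j, v). (u, v))"

lemma corner_sym: "corner a i j \<longleftrightarrow> corner a j i"
  unfolding corner_def by auto

lemma corner_mem: "corner a i j \<Longrightarrow> i \<in> I \<and> j \<in> I \<and> a \<in> N i \<and> a \<in> N j"
  unfolding corner_def by auto

lemma corner_count:
  "finite {j. corner a i j}" "card {j. corner a i j} \<le> 2 * d"
  "finite {j. corner a j i}" "card {j. corner a j i} \<le> 2 * d"
proof -
  show fin: "finite {j. corner a i j}"
    by (rule finite_subset[OF _ finite_I]) (auto simp: corner_def)
  show le: "card {j. corner a i j} \<le> 2 * d"
  proof (cases "i \<in> I \<and> a \<in> N i")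
    case True
    have "card {j. corner a i j} \<le> card {j\<in>I. a \<in> N j \<and> g a j = g a i}"
      using finite_I by (intro card_mono) (auto simp: corner_def)
    then show ?thesis
      using group_le[of i a] True by linarith
  next
    case False
    then have "{j. corner a i j} = {}"
      using corner_mem by blast
    then show ?thesis by simp
  qed
  have "{j. corner a j i} = {j. corner a i j}"
    using corner_sym by blast
  then show "finite {j. corner a j i}" "card {j. corner a j i} \<le> 2 * d"
    using fin le by auto
qed

lemma Inc: "finite Inc" "card Inc = M"
  unfolding Inc_def M_def using finite_I finite_N by (auto intro!: finite_SigmaI)

lemma finite_multi: "finite (multi i x)"
  unfolding multi_def using finite_I by auto

lemma Mul: "finite Mul" "card Mul \<le> 2 * M"
proof -
  show "finite Mul"
    unfolding Mul_def using Inc finite_multi by auto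
  have "card Mul = (\<Sum>q\<in>Inc. card (multi (fst q) (snd q)))"
    unfolding Mul_def using Inc finite_multi by auto
  also have "\<dots> = (\<Sum>i\<in>I. \<Sum>x\<in>N i. card (multi i x))"
    unfolding Inc_def using finite_I finite_N by (subst sum.Sigma) (auto simp: case_prod_beta)
  also have "\<dots> \<le> (\<Sum>i\<in>I. 2 * card (N i))"
    by (intro sum_mono multi_le)
  finally show "card Mul \<le> 2 * M"
    by (simp add: M_def sum_distrib_left)
qed

text \<open>Two different corners on a common first path form a 3-bridge with v and the two second
  paths, unless these agree; but then two paths meeting only once would meet in both corners. A
  common second path is treated dually.\<close>

lemma walk_eq:
  assumes F: "\<And>i x y. F i x y \<Longrightarrow> lt i x y" and G: "\<And>i x y. G i x y \<Longrightarrow> lt i x y"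
    and w: "(u, i, a, j, v) \<in> walks F G" "(u, i', a', j', v) \<in> walks F G" and eq: "i = i' \<or> j = j'"
  shows "i = i' \<and> a = a' \<and> j = j'"
proof -
  have c: "corner a i j" "corner a' i' j'" and lt: "lt i u a" "lt j a v" "lt i' u a'" "lt j' a' v"
    using w F G unfolding walks_def by auto
  note m = corner_mem[OF c(1)] corner_mem[OF c(2)]
  have ne: "i \<noteq> j" "i' \<noteq> j'" and int: "N i \<inter> N j = {a}" "N i' \<inter> N j' = {a'}"
    using c unfolding corner_def by auto
  show ?thesis
  proof (cases "a = a'")
    case True
    then have "i = i'" "j = j'"
      using no2[of i i' u a] no2[of j j' a v] lt m by auto
    then show ?thesis using True by simp
  next
    case False
    have "\<not> (i = i' \<and> j = j')"
      using False int by auto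
    moreover have "j = j'" if "i = i'"
      using lt_total[of i a a'] False m no3[of i j' j a a' v] no3[of i j j' a' a v] lt ne that by auto
    moreover have "i = i'" if "j = j'"
      using lt_total[of j a a'] False m no3[of i j i' u a a'] no3[of i' j i u a' a] lt ne that by auto
    ultimately show ?thesis using eq by auto
  qed
qed

text \<open>By \<open>walk_eq\<close>, two different walks with common ends differ in both paths. If
  the two paths at u or the two paths at v meet a second time, the pair is charged to
  \<open>Mul\<close>. Otherwise all crossings are simple and the two walks form two rungs of a
  ladder.\<close>

lemma walk_pairs_le:
  fixes F G :: "'i \<Rightarrow> 'a \<Rightarrow> 'a \<Rightarrow> bool" and f h :: nat
  assumes F: "\<And>i x y. F i x y \<Longrightarrow> lt i x y" and G: "\<And>i x y. G i x y \<Longrightarrow> lt i x y"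
    and Fc: "\<And>i x. i \<in> I \<Longrightarrow> card {y. F i x y} \<le> f" "\<And>i y. i \<in> I \<Longrightarrow> card {x. F i x y} \<le> f"
    and Gc: "\<And>i x. i \<in> I \<Longrightarrow> card {y. G i x y} \<le> h" "\<And>i y. i \<in> I \<Longrightarrow> card {x. G i x y} \<le> h"
  shows "finite (walks F G)"
    and "card {(\<alpha>, \<alpha>') \<in> walks F G \<times> walks F G. ends \<alpha> = ends \<alpha>'} \<le> 10 * d * f * h * M +
      (\<Sum>i\<in>I. \<Sum>k\<in>I. card {(c, c') \<in> ladder i k \<times> ladder i k. F i (fst c) (fst c') \<and> G k (snd c) (snd c')})"
proof -
  let ?W = "walks F G"
  have fin: "finite {y. F i x y}" "finite {x. F i x y}" "finite {y. G i x y}" "finite {x. G i x y}"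
    if "i \<in> I" for i x y
    by (rule finite_subset[OF _ finite_N[OF that]]; use F G in \<open>auto simp: before_def\<close>)+

  \<comment> \<open>A walk is built from the incidence (i, a) by choosing u, then j, then v, with at
    most \<open>f\<close>, \<open>2 * d\<close> and \<open>h\<close> possibilities.\<close>
  define S1 where "S1 = (SIGMA q:Inc. {u. F (fst q) u (snd q)})"
  define S2 where "S2 = (SIGMA q:S1. {j. corner (snd (fst q)) (fst (fst q)) j})"
  define S3 where "S3 = (SIGMA q:S2. {v. G (snd q) (snd (fst (fst q))) v})"
  have S1: "finite S1" "card S1 \<le> M * f"
    unfolding S1_def Inc(2)[symmetric]
    by - (rule finite_SigmaI[OF Inc(1)] card_Sigma_le[OF Inc(1)]; use fin Fc in \<open>auto simp: Inc_def\<close>)+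
  have S2: "finite S2" "card S2 \<le> card S1 * (2 * d)"
    unfolding S2_def by - (rule finite_SigmaI[OF S1(1)] card_Sigma_le[OF S1(1)]; simp add: corner_count)+
  have S2I: "snd q \<in> I" if "q \<in> S2" for q
    using that corner_mem unfolding S2_def by auto
  have S3: "finite S3" "card S3 \<le> card S2 * h"
    unfolding S3_def by - (rule finite_SigmaI[OF S2(1)] card_Sigma_le[OF S2(1)]; use S2I fin Gc in simp)+
  let ?f3 = "\<lambda>((((i, a), u), j), v). (u, i, a, j, v)"
  have W3: "?W \<subseteq> ?f3 ` S3"
  proof
    fix \<alpha> assume "\<alpha> \<in> ?W"
    then obtain u i a j v where al: "\<alpha> = (u, i, a, j, v)" "corner a i j" "F i u a" "G j a v"
      unfolding walks_def by auto
    then have "((((i, a), u), j), v) \<in> S3"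
      unfolding S3_def S2_def S1_def Inc_def using corner_mem by auto
    then show "\<alpha> \<in> ?f3 ` S3"
      unfolding al(1) by (rule rev_image_eqI) simp
  qed
  show finW: "finite ?W"
    using W3 S3(1) finite_surj by blast
  have cW: "card ?W \<le> 2 * d * f * h * M"
  proof -
    have "card ?W \<le> card S3"
      using W3 S3(1) surj_card_le by blast
    also have "\<dots> \<le> ((M * f) * (2 * d)) * h"
      using S3(2) S2(2) S1(2) by (meson le_trans mult_le_mono1)
    finally show ?thesis by (simp add: mult_ac)
  qed

  define P where "P = {(\<alpha>, \<alpha>') \<in> ?W \<times> ?W. ends \<alpha> = ends \<alpha>'}"
  define PV where "PV = {((u, i, a, j, v), (u', i', a', j', v')).
    ((u, i, a, j, v), (u', i', a', j', v')) \<in> P \<and> j' \<noteq> j \<and> N j \<inter> N j' \<noteq> {v}}"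
  define PU where "PU = {((u, i, a, j, v), (u', i', a', j', v')).
    ((u, i, a, j, v), (u', i', a', j', v')) \<in> P \<and> i' \<noteq> i \<and> N i \<inter> N i' \<noteq> {u}}"
  define PL where "PL = {((u, i, a, j, v), (u', i', a', j', v')).
    ((u, i, a, j, v), (u', i', a', j', v')) \<in> P \<and> i' \<noteq> i \<and> j' \<noteq> j \<and> N i \<inter> N i' = {u} \<and> N j \<inter> N j' = {v}}"
  have PD: "u' = u \<and> v' = v \<and> (u, i, a, j, v) \<in> ?W \<and> (u, i', a', j', v) \<in> ?W"
    if "((u, i, a, j, v), (u', i', a', j', v')) \<in> P" for u i a j v u' i' a' j' v'
    using that unfolding P_def ends_def by auto
  have weq: "i = i' \<and> a = a' \<and> j = j'"
    if "(u, i, a, j, v) \<in> ?W" "(u, i', a', j', v) \<in> ?W" "i = i' \<or> j = j'" for u i a j v i' a' j'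
    by (rule walk_eq[OF F G that])
  have cover: "P \<subseteq> (\<lambda>\<alpha>. (\<alpha>, \<alpha>)) ` ?W \<union> PV \<union> PU \<union> PL"
  proof
    fix q assume q: "q \<in> P"
    obtain u i a j v u' i' a' j' v' where qq: "q = ((u, i, a, j, v), (u', i', a', j', v'))"
      by (metis surj_pair)
    note pd = PD[OF q[unfolded qq]]
    show "q \<in> (\<lambda>\<alpha>. (\<alpha>, \<alpha>)) ` ?W \<union> PV \<union> PU \<union> PL"
    proof (cases "i = i' \<or> j = j'")
      case True
      then have "i = i' \<and> a = a' \<and> j = j'"
        using weq[of u i a j v i' a' j'] pd by blast
      then show ?thesis using pd qq by auto
    next
      case False
      then show ?thesis
        using q unfolding qq PV_def PU_def PL_def by auto
    qed
  qed
  have WD: "corner a i j \<and> F i u a \<and> G j a v" if "(u, i, a, j, v) \<in> ?W" for u i a j v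
    using that unfolding walks_def by auto
  have WM: "i \<in> I \<and> j \<in> I \<and> u \<in> N i \<and> a \<in> N i \<and> a \<in> N j \<and> v \<in> N j" if "(u, i, a, j, v) \<in> ?W" for u i a j v
    using WD[OF that] corner_mem F[of i u a] G[of j a v] unfolding before_def by blast
  have finP: "finite P"
    using finW unfolding P_def by (auto intro: finite_subset[of _ "?W \<times> ?W"])
  have finX: "finite PV" "finite PU" "finite PL"
    by (rule finite_subset[OF _ finP]; auto simp: PV_def PU_def PL_def)+

  have cV: "card PV \<le> 4 * d * f * h * M"
  proof -
    \<comment> \<open>From the multiple crossing of j and j' at v the first walk is built backwards.
      The second walk is then determined by u, j' and v through \<open>walk_eq\<close>.\<close>
    define T1 where "T1 = (SIGMA q:Mul. {a. G (fst (fst q)) a (snd (fst q))})"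
    define T2 where "T2 = (SIGMA q:T1. {i. corner (snd q) i (fst (fst (fst q)))})"
    define T3 where "T3 = (SIGMA q:T2. {u. F (snd q) u (snd (fst q))})"
    have T1: "finite T1" "card T1 \<le> card Mul * h"
      unfolding T1_def by - (rule finite_SigmaI[OF Mul(1)] card_Sigma_le[OF Mul(1)]; use fin Gc in \<open>auto simp: Mul_def Inc_def\<close>)+
    have T2: "finite T2" "card T2 \<le> card T1 * (2 * d)"
      unfolding T2_def by - (rule finite_SigmaI[OF T1(1)] card_Sigma_le[OF T1(1)]; simp add: corner_count)+
    have T2I: "snd q \<in> I" if "q \<in> T2" for q
      using that corner_mem unfolding T2_def by auto
    have T3: "finite T3" "card T3 \<le> card T2 * f"
      unfolding T3_def by - (rule finite_SigmaI[OF T2(1)] card_Sigma_le[OF T2(1)]; use T2I fin Fc in simp)+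
    define e where "e = (\<lambda>((u::'a, i::'i, a::'a, j::'i, v::'a), (u'::'a, i'::'i, a'::'a, j'::'i, v'::'a)). (((((j, v), j'), a), i), u))"
    have "e ` PV \<subseteq> T3"
    proof
      fix t assume "t \<in> e ` PV"
      then obtain u i a j v u' i' a' j' v' where z: "((u, i, a, j, v), (u', i', a', j', v')) \<in> PV"
        "t = e ((u, i, a, j, v), (u', i', a', j', v'))"
        by auto
      have q: "((u, i, a, j, v), (u', i', a', j', v')) \<in> P" "j' \<noteq> j"
        "N j \<inter> N j' \<noteq> {v}" "t = (((((j, v), j'), a), i), u)"
        using z unfolding PV_def e_def by simp_all
      note pd = PD[OF q(1)]
      then show "t \<in> T3"
        using WM[of u i a j v] WM[of u i' a' j' v] WD[of u i a j v] q(2,3)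
        unfolding q(4) T3_def T2_def T1_def Mul_def Inc_def multi_def by auto
    qed
    moreover have "inj_on e PV"
    proof (rule inj_onI)
      fix q r assume qr: "q \<in> PV" "r \<in> PV" "e q = e r"
      obtain u i a j v u' i' a' j' v' where q: "q = ((u, i, a, j, v), (u', i', a', j', v'))" "q \<in> P"
        using qr(1) unfolding PV_def by auto
      obtain x k b l y x' k' b' l' y' where r: "r = ((x, k, b, l, y), (x', k', b', l', y'))" "r \<in> P"
        using qr(2) unfolding PV_def by auto
      have eq: "u = x" "i = k" "a = b" "j = l" "v = y" "j' = l'"
        using qr(3) unfolding q(1) r(1) e_def by auto
      note p1 = PD[OF q(2)[unfolded q(1)]] and p2 = PD[OF r(2)[unfolded r(1)]]
      have "i' = k' \<and> a' = b' \<and> j' = l'"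
        using weq[of u i' a' j' v k' b' l'] p1 p2 eq by blast
      then show "q = r"
        using eq p1 p2 unfolding q(1) r(1) by auto
    qed
    ultimately have "card PV \<le> card T3"
      using T3(1) by (intro card_inj_on_le)
    also have "\<dots> \<le> ((2 * M * h) * (2 * d)) * f"
      using T3(2) T2(2) T1(2) Mul(2) by (meson le_trans mult_le_mono1)
    finally show ?thesis by (simp add: mult_ac)
  qed
  have cU: "card PU \<le> 4 * d * f * h * M"
  proof -
    \<comment> \<open>The mirror image of the previous count: the first walk is built forwards from
      a multiple crossing of i and i' at u.\<close>
    define T1 where "T1 = (SIGMA q:Mul. {a. F (fst (fst q)) (snd (fst q)) a})"
    define T2 where "T2 = (SIGMA q:T1. {j. corner (snd q) (fst (fst (fst q))) j})"
    define T3 where "T3 = (SIGMA q:T2. {v. G (snd q) (snd (fst q)) v})"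
    have T1: "finite T1" "card T1 \<le> card Mul * f"
      unfolding T1_def by - (rule finite_SigmaI[OF Mul(1)] card_Sigma_le[OF Mul(1)]; use fin Fc in \<open>auto simp: Mul_def Inc_def\<close>)+
    have T2: "finite T2" "card T2 \<le> card T1 * (2 * d)"
      unfolding T2_def by - (rule finite_SigmaI[OF T1(1)] card_Sigma_le[OF T1(1)]; simp add: corner_count)+
    have T2I: "snd q \<in> I" if "q \<in> T2" for q
      using that corner_mem unfolding T2_def by auto
    have T3: "finite T3" "card T3 \<le> card T2 * h"
      unfolding T3_def by - (rule finite_SigmaI[OF T2(1)] card_Sigma_le[OF T2(1)]; use T2I fin Gc in simp)+
    define e where "e = (\<lambda>((u::'a, i::'i, a::'a, j::'i, v::'a), (u'::'a, i'::'i, a'::'a, j'::'i, v'::'a)). (((((i, u), i'), a), j), v))"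
    have "e ` PU \<subseteq> T3"
    proof
      fix t assume "t \<in> e ` PU"
      then obtain u i a j v u' i' a' j' v' where z: "((u, i, a, j, v), (u', i', a', j', v')) \<in> PU"
        "t = e ((u, i, a, j, v), (u', i', a', j', v'))"
        by auto
      have q: "((u, i, a, j, v), (u', i', a', j', v')) \<in> P" "i' \<noteq> i"
        "N i \<inter> N i' \<noteq> {u}" "t = (((((i, u), i'), a), j), v)"
        using z unfolding PU_def e_def by simp_all
      note pd = PD[OF q(1)]
      then show "t \<in> T3"
        using WM[of u i a j v] WM[of u i' a' j' v] WD[of u i a j v] q(2,3)
        unfolding q(4) T3_def T2_def T1_def Mul_def Inc_def multi_def by auto
    qed
    moreover have "inj_on e PU"
    proof (rule inj_onI)
      fix q r assume qr: "q \<in> PU" "r \<in> PU" "e q = e r"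
      obtain u i a j v u' i' a' j' v' where q: "q = ((u, i, a, j, v), (u', i', a', j', v'))" "q \<in> P"
        using qr(1) unfolding PU_def by auto
      obtain x k b l y x' k' b' l' y' where r: "r = ((x, k, b, l, y), (x', k', b', l', y'))" "r \<in> P"
        using qr(2) unfolding PU_def by auto
      have eq: "u = x" "i = k" "a = b" "j = l" "v = y" "i' = k'"
        using qr(3) unfolding q(1) r(1) e_def by auto
      note p1 = PD[OF q(2)[unfolded q(1)]] and p2 = PD[OF r(2)[unfolded r(1)]]
      have "i' = k' \<and> a' = b' \<and> j' = l'"
        using weq[of u i' a' j' v k' b' l'] p1 p2 eq by blast
      then show "q = r"
        using eq p1 p2 unfolding q(1) r(1) by auto
    qed
    ultimately have "card PU \<le> card T3"
      using T3(1) by (intro card_inj_on_le)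
    also have "\<dots> \<le> ((2 * M * f) * (2 * d)) * h"
      using T3(2) T2(2) T1(2) Mul(2) by (meson le_trans mult_le_mono1)
    finally show ?thesis by (simp add: mult_ac)
  qed

  define skew where "skew i k = {(c, c') \<in> ladder i k \<times> ladder i k. F i (fst c) (fst c') \<and> G k (snd c) (snd c')}" for i k
  have fin_skew: "finite (skew i k)" if "i \<in> I" "k \<in> I" for i k
    using finite_ladder[OF that] unfolding skew_def by (auto intro: finite_subset[of _ "ladder i k \<times> ladder i k"])
  have cL: "card PL \<le> (\<Sum>i\<in>I. \<Sum>k\<in>I. card (skew i k))"
  proof -
    define Y where "Y = (SIGMA q:I \<times> I. skew (fst q) (snd q))"
    \<comment> \<open>In the ladder from i to j', the path i' is the rung (u, a') and j is the rung
      (a, v). The \<open>F\<close>-step of the first walk joins their ends on i, the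
      \<open>G\<close>-step of the second walk joins their ends on j'. These data and
      \<open>walk_eq\<close> determine both walks.\<close>
    define e where "e = (\<lambda>((u::'a, i::'i, a::'a, j::'i, v::'a), (u'::'a, i'::'i, a'::'a, j'::'i, v'::'a)). ((i, j'), ((u, a'), (a, v))))"
    have finY: "finite Y"
      unfolding Y_def using fin_skew finite_I by auto
    have cY: "card Y = (\<Sum>i\<in>I. \<Sum>k\<in>I. card (skew i k))"
      unfolding Y_def using fin_skew finite_I
      by (subst card_SigmaI) (auto simp: sum.cartesian_product case_prod_beta)
    have "e ` PL \<subseteq> Y"
    proof
      fix t assume "t \<in> e ` PL"
      then obtain u i a j v u' i' a' j' v' where z: "((u, i, a, j, v), (u', i', a', j', v')) \<in> PL"
        "t = e ((u, i, a, j, v), (u', i', a', j', v'))"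
        by auto
      have q: "((u, i, a, j, v), (u', i', a', j', v')) \<in> P" "i' \<noteq> i" "j' \<noteq> j"
        "N i \<inter> N i' = {u}" "N j \<inter> N j' = {v}" "t = ((i, j'), ((u, a'), (a, v)))"
        using z unfolding PL_def e_def by simp_all
      note pd = PD[OF q(1)]
      note w = WM[of u i a j v] WM[of u i' a' j' v] WD[of u i a j v] WD[of u i' a' j' v]
      have lt: "lt i' u a'" "lt j a v"
        using w pd F G by auto
      have c: "i \<noteq> j" "i' \<noteq> j'" "N i \<inter> N j = {a}" "N i' \<inter> N j' = {a'}"
        using w pd unfolding corner_def by auto
      have "i \<noteq> j'"
      proof
        assume "i = j'"
        then have "v \<in> N i \<inter> N j" using w pd by auto
        then show False using c(3) lt(2) by (auto simp: before_def)
      qed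
      have "i' \<in> I" "j \<in> I" "i \<in> I" "j' \<in> I"
        using w pd by auto
      then have "(u, a') \<in> ladder i j'" "(a, v) \<in> ladder i j'"
        using ladderI[of i j' i' u a'] ladderI[of i j' j a v] \<open>i \<noteq> j'\<close> lt c q(2-5) by auto
      then show "t \<in> Y"
        unfolding q(6) Y_def skew_def using w pd \<open>i \<in> I\<close> \<open>j' \<in> I\<close> by simp
    qed
    moreover have "inj_on e PL"
    proof (rule inj_onI)
      fix q r assume qr: "q \<in> PL" "r \<in> PL" "e q = e r"
      obtain u i a j v u' i' a' j' v' where q: "q = ((u, i, a, j, v), (u', i', a', j', v'))" "q \<in> P"
        using qr(1) unfolding PL_def by auto
      obtain x k b l y x' k' b' l' y' where r: "r = ((x, k, b, l, y), (x', k', b', l', y'))" "r \<in> P"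
        using qr(2) unfolding PL_def by auto
      have eq: "u = x" "i = k" "a = b" "v = y" "a' = b'" "j' = l'"
        using qr(3) unfolding q(1) r(1) e_def by auto
      note p1 = PD[OF q(2)[unfolded q(1)]] and p2 = PD[OF r(2)[unfolded r(1)]]
      have "i' = k' \<and> a' = b' \<and> j' = l'"
        using weq[of u i' a' j' v k' b' l'] p1 p2 eq by blast
      moreover have "i = k \<and> a = b \<and> j = l"
        using weq[of u i a j v k b l] p1 p2 eq by blast
      ultimately show "q = r"
        using eq p1 p2 unfolding q(1) r(1) by auto
    qed
    ultimately have "card PL \<le> card Y"
      using finY by (intro card_inj_on_le)
    then show ?thesis using cY by simp
  qed

  have "card P \<le> card ((\<lambda>\<alpha>. (\<alpha>, \<alpha>)) ` ?W \<union> PV \<union> PU \<union> PL)"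
    using cover finW finX by (intro card_mono) auto
  also have "\<dots> \<le> card ?W + card PV + card PU + card PL"
  proof -
    have "card ((\<lambda>\<alpha>. (\<alpha>, \<alpha>)) ` ?W) \<le> card ?W"
      using finW card_image_le by blast
    then show ?thesis
      using card_Un_le[of "(\<lambda>\<alpha>. (\<alpha>, \<alpha>)) ` ?W \<union> PV \<union> PU" PL] card_Un_le[of "(\<lambda>\<alpha>. (\<alpha>, \<alpha>)) ` ?W \<union> PV" PU]
        card_Un_le[of "(\<lambda>\<alpha>. (\<alpha>, \<alpha>)) ` ?W" PV] by linarith
  qed
  also have "\<dots> \<le> 2 * d * f * h * M + 4 * d * f * h * M + 4 * d * f * h * M + (\<Sum>i\<in>I. \<Sum>k\<in>I. card (skew i k))"
    using cW cV cU cL by linarith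
  finally show "card {(\<alpha>, \<alpha>') \<in> ?W \<times> ?W. ends \<alpha> = ends \<alpha>'} \<le> 10 * d * f * h * M +
      (\<Sum>i\<in>I. \<Sum>k\<in>I. card {(c, c') \<in> ladder i k \<times> ladder i k. F i (fst c) (fst c') \<and> G k (snd c) (snd c')})"
    unfolding P_def skew_def by simp
qed

end

section \<open>Short and long steps\<close>

locale scaled_dense_family = dense_family I N pos g d
  for I :: "'i set" and N :: "'i \<Rightarrow> 'a set" and pos g d +
  fixes L s :: nat
  assumes length_ge: "i \<in> I \<Longrightarrow> 4 * L \<le> card (N i)"
    and scales: "0 < L" "0 < s" "s \<le> 4 * L" and d_ge: "34 \<le> d"
begin

text \<open>Short steps are tied to a fixed grid of cells, so that they can be detected by comparing
  cell indices in \<open>key\<close>.\<close>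

definition "sh i x y \<longleftrightarrow> i \<in> I \<and> lt i x y \<and> pos i x div s = pos i y div s"

definition "lg i x y \<longleftrightarrow> i \<in> I \<and> lt i x y \<and> pos i x + L \<le> pos i y \<and> pos i y < pos i x + 2 * L"

lemma card_le_window:
  assumes "i \<in> I" "A \<subseteq> N i" "pos i ` A \<subseteq> {m..<m + c}"
  shows "card A \<le> c"
proof -
  have "card A \<le> card {m..<m + c}"
    using assms pos_inj[of i] by (intro card_inj_on_le[of "pos i"]) (auto intro: inj_on_subset)
  then show ?thesis by simp
qed

lemma sh_count: "i \<in> I \<Longrightarrow> card {y. sh i x y} \<le> s" "i \<in> I \<Longrightarrow> card {y. sh i y x} \<le> s"
proof -
  have *: "n \<in> {m div s * s..<m div s * s + s}" if "n div s = m div s" for n m :: nat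
    using that scales(2) by (metis add.commute atLeastLessThan_iff div_times_less_eq_dividend dividend_less_div_times)
  show "card {y. sh i x y} \<le> s" if "i \<in> I"
    using that * by (intro card_le_window[of i _ "pos i x div s * s"]) (auto simp: sh_def before_def)
  show "card {y. sh i y x} \<le> s" if "i \<in> I"
    using that * by (intro card_le_window[of i _ "pos i x div s * s"]) (auto simp: sh_def before_def)
qed

lemma lg_count: "i \<in> I \<Longrightarrow> card {y. lg i x y} \<le> L" "i \<in> I \<Longrightarrow> card {y. lg i y x} \<le> L"
proof -
  show "card {y. lg i x y} \<le> L" if "i \<in> I"
    using that by (intro card_le_window[of i _ "pos i x + L"]) (auto simp: lg_def before_def)
  show "card {y. lg i y x} \<le> L" if "i \<in> I"
    \<comment> \<open>Truncated subtraction is harmless: if \<open>pos i x + 1 < 2 * L\<close>, a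
      node at distance at least \<open>L\<close> below x has position below
      \<open>L\<close>.\<close>
    using that by (intro card_le_window[of i _ "pos i x + 1 - 2 * L"]) (auto simp: lg_def before_def)
qed

lemma sh_lt: "sh i x y \<Longrightarrow> lt i x y" and lg_lt: "lg i x y \<Longrightarrow> lt i x y"
  by (auto simp: sh_def lg_def)

text \<open>\<open>ladder_mono\<close> makes the positions of the rung ends a chain, so
  \<open>skew_pairs_of_chain\<close> applies, with the short coordinate on i in the first case and
  on k in the second.\<close>

lemma skew_ladder_le:
  assumes "i \<in> I" "k \<in> I"
  shows "L * card {(c, c') \<in> ladder i k \<times> ladder i k. sh i (fst c) (fst c') \<and> lg k (snd c) (snd c')} \<le> s\<^sup>2 * card (N k)"
    and "L * card {(c, c') \<in> ladder i k \<times> ladder i k. lg i (fst c) (fst c') \<and> sh k (snd c) (snd c')} \<le> s\<^sup>2 * card (N i)"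
proof -
  define e where "e = (\<lambda>c::'a \<times> 'a. (pos i (fst c), pos k (snd c)))"
  define e' where "e' = (\<lambda>c::'a \<times> 'a. (pos k (snd c), pos i (fst c)))"
  have inj: "inj_on e (ladder i k)" "inj_on e' (ladder i k)"
    using pos_eqD[OF assms(1)] pos_eqD[OF assms(2)] ladder_mem
    unfolding e_def e'_def by (auto intro!: inj_onI prod_eqI)
  have bound: "pos i x < card (N i)" "pos k y < card (N k)" if "(x, y) \<in> ladder i k" for x y
    using pos_less ladder_mem[OF that] assms by auto
  let ?C = "e ` ladder i k" and ?C' = "e' ` ladder i k"
  let ?Z = "{(c, c') \<in> ?C \<times> ?C. fst c < fst c' \<and> fst c div s = fst c' div s \<and> snd c + L \<le> snd c'}"
  let ?Z' = "{(c, c') \<in> ?C' \<times> ?C'. fst c < fst c' \<and> fst c div s = fst c' div s \<and> snd c + L \<le> snd c'}"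
  have mono: "x < x' \<longleftrightarrow> y < y'" if "(x, y) \<in> ?C" "(x', y') \<in> ?C" for x y x' y'
    using that ladder_mono[OF assms] unfolding e_def by auto
  have mono': "x < x' \<longleftrightarrow> y < y'" if "(x, y) \<in> ?C'" "(x', y') \<in> ?C'" for x y x' y'
    using that ladder_mono[OF assms] unfolding e'_def by auto
  have bC: "y < card (N k)" if "(x, y) \<in> ?C" for x y
    using that bound unfolding e_def by auto
  have bC': "y < card (N i)" if "(x, y) \<in> ?C'" for x y
    using that bound unfolding e'_def by auto
  have Z: "finite ?Z" "card ?Z \<le> s\<^sup>2 * (card (N k) div L)"
    by (rule skew_pairs_of_chain[OF mono bC scales(2,1)]; assumption)+
  have Z': "finite ?Z'" "card ?Z' \<le> s\<^sup>2 * (card (N i) div L)"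
    by (rule skew_pairs_of_chain[OF mono' bC' scales(2,1)]; assumption)+
  have times: "L * q \<le> s\<^sup>2 * m" if "q \<le> s\<^sup>2 * (m div L)" for q m :: nat
  proof -
    have "L * q \<le> s\<^sup>2 * (L * (m div L))"
      using mult_le_mono2[OF that, of L] by (simp add: mult_ac)
    also have "\<dots> \<le> s\<^sup>2 * m"
      by (intro mult_le_mono2) simp
    finally show ?thesis .
  qed
  show "L * card {(c, c') \<in> ladder i k \<times> ladder i k. sh i (fst c) (fst c') \<and> lg k (snd c) (snd c')} \<le> s\<^sup>2 * card (N k)"
  proof (rule times, rule order.trans[OF card_inj_on_le[of "map_prod e e" _ ?Z] Z(2)])
    show "inj_on (map_prod e e) {(c, c') \<in> ladder i k \<times> ladder i k. sh i (fst c) (fst c') \<and> lg k (snd c) (snd c')}"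
      using inj by (intro inj_on_subset[OF map_prod_inj_on[OF inj(1) inj(1)]]) auto
    show "map_prod e e ` {(c, c') \<in> ladder i k \<times> ladder i k. sh i (fst c) (fst c') \<and> lg k (snd c) (snd c')} \<subseteq> ?Z"
      by (auto simp: e_def sh_def lg_def before_def)
  qed (fact Z(1))
  show "L * card {(c, c') \<in> ladder i k \<times> ladder i k. lg i (fst c) (fst c') \<and> sh k (snd c) (snd c')} \<le> s\<^sup>2 * card (N i)"
  proof (rule times, rule order.trans[OF card_inj_on_le[of "map_prod e' e'" _ ?Z'] Z'(2)])
    show "inj_on (map_prod e' e') {(c, c') \<in> ladder i k \<times> ladder i k. lg i (fst c) (fst c') \<and> sh k (snd c) (snd c')}"
      using inj by (intro inj_on_subset[OF map_prod_inj_on[OF inj(2) inj(2)]]) auto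
    show "map_prod e' e' ` {(c, c') \<in> ladder i k \<times> ladder i k. lg i (fst c) (fst c') \<and> sh k (snd c) (snd c')} \<subseteq> ?Z'"
      by (auto simp: e'_def sh_def lg_def before_def)
  qed (fact Z'(1))
qed

text \<open>Both terms come from \<open>walk_pairs_le\<close> after multiplication by
  \<open>L\<close>: the first from equal or multiply crossing walks, the second from
  ladders.\<close>

definition "bound = 10 * d * s * L\<^sup>2 * M + s\<^sup>2 * card I * M"

lemma same_end_pairs_le:
  "L * card {(\<alpha>, \<alpha>') \<in> walks sh lg \<times> walks sh lg. ends \<alpha> = ends \<alpha>'} \<le> bound"
  "L * card {(\<alpha>, \<alpha>') \<in> walks lg sh \<times> walks lg sh. ends \<alpha> = ends \<alpha>'} \<le> bound"
proof -
  have finish: "L * q \<le> bound" if q: "q \<le> 10 * d * s * L * M + (\<Sum>i\<in>I. \<Sum>k\<in>I. S i k)"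
    and S: "(\<Sum>i\<in>I. \<Sum>k\<in>I. L * S i k) \<le> s\<^sup>2 * card I * M" for q and S :: "'i \<Rightarrow> 'i \<Rightarrow> nat"
  proof -
    have "L * q \<le> L * (10 * d * s * L * M) + (\<Sum>i\<in>I. \<Sum>k\<in>I. L * S i k)"
      using mult_le_mono2[OF q, of L] by (simp add: distrib_left sum_distrib_left)
    then show ?thesis
      using S unfolding bound_def by (simp add: power2_eq_square mult_ac)
  qed
  have "(\<Sum>i\<in>I. \<Sum>k\<in>I. L * card {(c, c') \<in> ladder i k \<times> ladder i k. sh i (fst c) (fst c') \<and> lg k (snd c) (snd c')})
    \<le> (\<Sum>i\<in>I. \<Sum>k\<in>I. s\<^sup>2 * card (N k))"
    by (intro sum_mono skew_ladder_le)
  also have "\<dots> = s\<^sup>2 * card I * M"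
    by (simp add: M_def sum_distrib_left mult_ac)
  finally show "L * card {(\<alpha>, \<alpha>') \<in> walks sh lg \<times> walks sh lg. ends \<alpha> = ends \<alpha>'} \<le> bound"
    using walk_pairs_le(2)[OF sh_lt lg_lt sh_count lg_count] by (intro finish) auto
  have "(\<Sum>i\<in>I. \<Sum>k\<in>I. L * card {(c, c') \<in> ladder i k \<times> ladder i k. lg i (fst c) (fst c') \<and> sh k (snd c) (snd c')})
    \<le> (\<Sum>i\<in>I. \<Sum>k\<in>I. s\<^sup>2 * card (N i))"
    by (intro sum_mono skew_ladder_le)
  also have "\<dots> = s\<^sup>2 * card I * M"
    by (simp add: M_def sum_distrib_left mult_ac)
  finally show "L * card {(\<alpha>, \<alpha>') \<in> walks lg sh \<times> walks lg sh. ends \<alpha> = ends \<alpha>'} \<le> bound"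
    using walk_pairs_le(2)[OF lg_lt sh_lt lg_count sh_count] by (intro finish) (auto simp: mult_ac)
qed

lemma finite_walks: "finite (walks sh lg)" "finite (walks lg sh)"
  using walk_pairs_le(1)[OF sh_lt lg_lt sh_count lg_count] walk_pairs_le(1)[OF lg_lt sh_lt lg_count sh_count] by auto

text \<open>These are the thin diamonds. Walks with common ends bound their number from above, rungs
  with equal key from below.\<close>

definition "AB = {(\<alpha>, \<beta>) \<in> walks sh lg \<times> walks lg sh. ends \<alpha> = ends \<beta>}"

lemma AB: "finite AB" "L * card AB \<le> bound"
proof -
  show "finite AB"
    unfolding AB_def using finite_walks by (auto intro: finite_subset[of _ "walks sh lg \<times> walks lg sh"])
  have "L * (2 * card AB) \<le> L * card {(\<alpha>, \<alpha>') \<in> walks sh lg \<times> walks sh lg. ends \<alpha> = ends \<alpha>'}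
    + L * card {(\<alpha>, \<alpha>') \<in> walks lg sh \<times> walks lg sh. ends \<alpha> = ends \<alpha>'}"
    unfolding AB_def add_mult_distrib2[symmetric]
    by (rule mult_le_mono2[OF card_mixed_key_pairs_le[OF finite_walks]])
  then show "L * card AB \<le> bound"
    using same_end_pairs_le by linarith
qed

section \<open>Counting rungs\<close>

definition "rungs = {(i, x, j, y, k). corner x i j \<and> lg j x y \<and> corner y j k}"

text \<open>Along a ladder both cell indices are monotone, so equal sums force both indices to be
  equal. Using the sum keeps the number of keys per ladder linear in the path lengths over
  \<open>s\<close>, where the pair of indices would give a product.\<close>

definition "key = (\<lambda>(i, x, j, y, k). (i, k, pos i x div s + pos k y div s))"

lemma rung_ladder:
  assumes "(i, x, j, y, k) \<in> rungs"
  shows "(x, y) \<in> ladder i k" "i \<in> I" "j \<in> I" "k \<in> I" "x \<in> N i" "y \<in> N k" "lt j x y"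
proof -
  have r: "corner x i j" "lg j x y" "corner y j k"
    using assms unfolding rungs_def by auto
  then show I: "i \<in> I" "j \<in> I" "k \<in> I" and mem: "x \<in> N i" "y \<in> N k" and lt: "lt j x y"
    using corner_mem lg_lt by blast+
  have "i \<noteq> k"
    using r(1,3) lt unfolding corner_def before_def by auto
  then show "(x, y) \<in> ladder i k"
    using r lt I ladderI[of i k j x y] unfolding corner_def by auto
qed

lemma finite_rungs: "finite rungs"
proof -
  have "rungs \<subseteq> I \<times> (\<Union>i\<in>I. N i) \<times> I \<times> (\<Union>i\<in>I. N i) \<times> I"
  proof
    fix r assume r: "r \<in> rungs"
    obtain i x j y k where rr: "r = (i, x, j, y, k)"
      by (metis surj_pair)
    show "r \<in> I \<times> (\<Union>i\<in>I. N i) \<times> I \<times> (\<Union>i\<in>I. N i) \<times> I"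
      using rung_ladder[OF r[unfolded rr]] unfolding rr by auto
  qed
  then show ?thesis
    by (rule finite_subset) (use finite_I finite_N in auto)
qed

text \<open>By monotonicity of ladders, two rungs with the same key start in the same short cell of \<open>i\<close> and end
  in the same short cell of \<open>k\<close>: they span a diamond with two short and two long sides.\<close>

lemma rung_key_pairs_le: "card {(r, r') \<in> rungs \<times> rungs. key r = key r'} \<le> card rungs + 2 * card AB"
proof -
  define Q where "Q = {((i, x, j, y, k), (i', x', j', y', k')). (i, x, j, y, k) \<in> rungs \<and> (i', x', j', y', k') \<in> rungs
    \<and> key (i, x, j, y, k) = key (i', x', j', y', k') \<and> pos i x < pos i x'}"
  \<comment> \<open>The two sides of the diamond from x to y': short on i to x' and then long on j',
    or long on j to y and then short on k.\<close>
  define e where "e = (\<lambda>((i::'i, x::'a, j::'i, y::'a, k::'i), (i'::'i, x'::'a, j'::'i, y'::'a, k'::'i)).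
    ((x, i, x', j', y'), (x, j, y, k, y')))"
  have QD: "i' = i \<and> k' = k \<and> sh i x x' \<and> sh k y y'"
    if "((i, x, j, y, k), (i', x', j', y', k')) \<in> Q" for i x j y k i' x' j' y' k'
  proof -
    have q: "(i, x, j, y, k) \<in> rungs" "(i', x', j', y', k') \<in> rungs" "i' = i" "k' = k" "pos i x < pos i x'"
      "pos i x div s + pos k y div s = pos i x' div s + pos k y' div s"
      using that unfolding Q_def key_def by auto
    note r = rung_ladder[OF q(1)] rung_ladder[OF q(2), unfolded q(3,4)]
    have less: "pos k y < pos k y'"
      using ladder_mono[OF r(2,4) r(1,8)] q(5) by blast
    have "pos i x div s \<le> pos i x' div s" "pos k y div s \<le> pos k y' div s"
      using q(5) less by (auto intro: div_le_mono)
    then have "pos i x div s = pos i x' div s" "pos k y div s = pos k y' div s"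
      using q(6) by linarith+
    then show ?thesis
      using q(3-5) less r unfolding sh_def before_def by auto
  qed
  have "e ` Q \<subseteq> AB"
  proof
    fix t assume "t \<in> e ` Q"
    then obtain i x j y k i' x' j' y' k' where z: "((i, x, j, y, k), (i', x', j', y', k')) \<in> Q"
      "t = e ((i, x, j, y, k), (i', x', j', y', k'))"
      by auto
    have "(i, x, j, y, k) \<in> rungs" "(i', x', j', y', k') \<in> rungs"
      using z(1) unfolding Q_def by auto
    then show "t \<in> AB"
      using QD[OF z(1)] unfolding z(2) e_def AB_def walks_def rungs_def ends_def by auto
  qed
  moreover have "inj_on e Q"
  proof (rule inj_onI)
    fix q r assume qr: "q \<in> Q" "r \<in> Q" "e q = e r"
    obtain i x j y k i' x' j' y' k' where q: "q = ((i, x, j, y, k), (i', x', j', y', k'))"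
      by (metis surj_pair)
    obtain l u m v n l' u' m' v' n' where r: "r = ((l, u, m, v, n), (l', u', m', v', n'))"
      by (metis surj_pair)
    show "q = r"
      using qr(3) QD[OF qr(1)[unfolded q]] QD[OF qr(2)[unfolded r]] unfolding q r e_def by auto
  qed
  ultimately have cQ: "card Q \<le> card AB"
    using AB(1) by (intro card_inj_on_le)
  have finQ: "finite Q"
    by (rule finite_subset[of _ "rungs \<times> rungs"]) (use finite_rungs in \<open>auto simp: Q_def\<close>)
  have "{(r, r') \<in> rungs \<times> rungs. key r = key r'} \<subseteq> (\<lambda>r. (r, r)) ` rungs \<union> Q \<union> prod.swap ` Q"
  proof
    fix t assume t: "t \<in> {(r, r') \<in> rungs \<times> rungs. key r = key r'}"
    obtain i x j y k i' x' j' y' k' where tt: "t = ((i, x, j, y, k), (i', x', j', y', k'))"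
      by (metis surj_pair)
    have q: "(i, x, j, y, k) \<in> rungs" "(i', x', j', y', k') \<in> rungs" "i' = i" "k' = k"
      "key (i, x, j, y, k) = key (i', x', j', y', k')"
      using t unfolding tt key_def by auto
    note r = rung_ladder[OF q(1)] rung_ladder[OF q(2), unfolded q(3,4)]
    consider "pos i x < pos i x'" | "pos i x' < pos i x" | "pos i x = pos i x'"
      by linarith
    then show "t \<in> (\<lambda>r. (r, r)) ` rungs \<union> Q \<union> prod.swap ` Q"
    proof cases
      case 1
      then have "t \<in> Q" unfolding tt Q_def using q by auto
      then show ?thesis by blast
    next
      case 2
      then have "prod.swap t \<in> Q" unfolding tt Q_def using q by auto
      then have "t \<in> prod.swap ` Q" by (metis image_eqI swap_swap)
      then show ?thesis by blast
    next
      case 3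
      then have xx: "x = x'"
        using pos_eqD[OF r(2)] r by blast
      have "pos k y = pos k y'"
        using ladder_mono[OF r(2,4) r(1,8)] ladder_mono[OF r(2,4) r(8,1)] 3 by linarith
      then have yy: "y = y'"
        using pos_eqD[OF r(4)] r by blast
      have "j = j'"
        using no2[of j j' x y] r xx yy by blast
      then show ?thesis
        using xx yy q unfolding tt by auto
    qed
  qed
  then have "card {(r, r') \<in> rungs \<times> rungs. key r = key r'} \<le> card ((\<lambda>r. (r, r)) ` rungs \<union> Q \<union> prod.swap ` Q)"
    using finQ finite_rungs by (intro card_mono) auto
  also have "\<dots> \<le> card ((\<lambda>r. (r, r)) ` rungs) + card Q + card (prod.swap ` Q)"
    by (rule order.trans[OF card_Un_le add_mono[OF card_Un_le order.refl]])
  also have "\<dots> \<le> card rungs + 2 * card AB"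
    using card_image_le[OF finite_rungs, of "\<lambda>r. (r, r)"] card_image_le[OF finQ, of prod.swap] cQ by linarith
  finally show ?thesis .
qed

lemma keys_le: "\<exists>T. finite T \<and> key ` rungs \<subseteq> T \<and> s * card T \<le> 3 * card I * M"
proof -
  define T where "T = (\<lambda>((i, k), c). (i, k, c)) ` (SIGMA q:I \<times> I. {..card (N (fst q)) div s + card (N (snd q)) div s})"
  have "finite T"
    unfolding T_def using finite_I by auto
  moreover have "key ` rungs \<subseteq> T"
  proof
    fix t assume "t \<in> key ` rungs"
    then obtain i x j y k where r: "(i, x, j, y, k) \<in> rungs" "t = (i, k, pos i x div s + pos k y div s)"
      unfolding key_def by auto
    note rl = rung_ladder[OF r(1)]
    have "pos i x div s + pos k y div s \<le> card (N i) div s + card (N k) div s"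
      using pos_less rl by (intro add_mono div_le_mono) (auto intro: less_imp_le)
    then show "t \<in> T"
      unfolding T_def r(2) using rl by (intro image_eqI[of _ _ "((i, k), pos i x div s + pos k y div s)"]) auto
  qed
  moreover have "s * card T \<le> 3 * card I * M"
  proof -
    have "card T \<le> card (SIGMA q:I \<times> I. {..card (N (fst q)) div s + card (N (snd q)) div s})"
      unfolding T_def using finite_I by (intro card_image_le) auto
    also have "\<dots> = (\<Sum>i\<in>I. \<Sum>k\<in>I. card (N i) div s + card (N k) div s + 1)"
      using finite_I by (simp add: sum.cartesian_product case_prod_beta)
    finally have "s * card T \<le> (\<Sum>i\<in>I. \<Sum>k\<in>I. s * (card (N i) div s + card (N k) div s + 1))"
      unfolding sum_distrib_left[symmetric] by (rule mult_le_mono2)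
    \<comment> \<open>The summand 1 from the closed range of cell sums costs \<open>s\<close>, which
      is at most \<open>4 * L\<close> and so at most \<open>card (N i)\<close>.\<close>
    also have "\<dots> \<le> (\<Sum>i\<in>I. \<Sum>k\<in>I. card (N i) + card (N k) + card (N i))"
    proof (intro sum_mono)
      fix i k assume "i \<in> I" "k \<in> I"
      then have "s \<le> card (N i)"
        using length_ge scales(3) le_trans by blast
      then show "s * (card (N i) div s + card (N k) div s + 1) \<le> card (N i) + card (N k) + card (N i)"
        using times_div_less_eq_dividend[of s "card (N i)"] times_div_less_eq_dividend[of s "card (N k)"]
        unfolding distrib_left mult_1_right by linarith
    qed
    also have "\<dots> = 3 * card I * M"
      by (simp add: sum.distrib M_def sum_distrib_left sum_distrib_right mult_ac flip: sum_distrib_left)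
    finally show ?thesis .
  qed
  ultimately show ?thesis by blast
qed

text \<open>In the group of j at x, only j itself and its multiple crossings at x fail to form a
  corner with j.\<close>

lemma corner_count_ge:
  assumes "j \<in> I" "x \<in> N j"
  shows "d \<le> card {i. corner x i j} + 1 + card (multi j x)"
proof -
  have "{i\<in>I. x \<in> N i \<and> g x i = g x j} \<subseteq> {i. corner x i j} \<union> {j} \<union> multi j x"
    using assms unfolding corner_def multi_def by auto
  then have "card {i\<in>I. x \<in> N i \<and> g x i = g x j} \<le> card ({i. corner x i j} \<union> {j} \<union> multi j x)"
    using corner_count finite_multi by (intro card_mono) auto
  also have "\<dots> \<le> card {i. corner x i j} + 1 + card (multi j x)"
    using card_Un_le[of "{i. corner x i j} \<union> {j}" "multi j x"] card_Un_le[of "{i. corner x i j}" "{j}"] by simp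
  finally show ?thesis
    using group_ge[OF assms] by linarith
qed

text \<open>The threshold serves two ends: by \<open>multi_le\<close> at most an eighth of the nodes
  of a path are bad, and since \<open>34 \<le> d\<close> a good node keeps at least d - 17 \<ge> d/2
  corners.\<close>

definition "good j = {x\<in>N j. card (multi j x) \<le> 16}"

definition "gpairs j = {(x, y) \<in> good j \<times> good j. lg j x y}"

lemma gpairs_ge:
  assumes j: "j \<in> I"
  shows "finite (gpairs j)" "L * card (N j) \<le> 4 * card (gpairs j)"
proof -
  let ?n = "card (N j)"
  have fin: "finite (N j)" using finite_N j .
  show fing: "finite (gpairs j)"
    unfolding gpairs_def good_def by (rule finite_subset[of _ "N j \<times> N j"]) (use fin in auto)
  define bad where "bad = N j - good j"
  define B where "B = pos j ` bad"
  have "17 * card bad = (\<Sum>x\<in>bad. 17)" by simp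
  also have "\<dots> \<le> (\<Sum>x\<in>bad. card (multi j x))"
    by (intro sum_mono) (auto simp: bad_def good_def)
  also have "\<dots> \<le> (\<Sum>x\<in>N j. card (multi j x))"
    using fin by (intro sum_mono2) (auto simp: bad_def)
  also have "\<dots> \<le> 2 * ?n"
    using multi_le[OF j] .
  finally have "8 * card bad \<le> ?n" by simp
  moreover have "finite bad" using fin by (auto simp: bad_def)
  ultimately have B: "finite B" "8 * card B \<le> ?n"
    using card_image_le[of bad "pos j"] by (auto simp: B_def)
  \<comment> \<open>\<open>X c\<close> holds the starts of good pairs at distance c. At most half of
    the positions are lost at the end of the path, since c < 2L, and at most a quarter because one
    of the two nodes is bad. Hence a quarter remains for each of the \<open>L\<close>
    distances.\<close>
  define X where "X c = {m\<in>{..<?n - c}. m \<notin> B \<and> m + c \<notin> B}" for c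
  have X: "?n \<le> 4 * card (X c)" if c: "c \<in> {L..<2 * L}" for c
  proof -
    let ?B' = "(\<lambda>m. m - c) ` B"
    have "{..<?n - c} \<subseteq> X c \<union> B \<union> ?B'"
    proof
      fix m assume m: "m \<in> {..<?n - c}"
      have "m \<in> ?B'" if "m + c \<in> B"
        using that by (intro image_eqI[of _ _ "m + c"]) auto
      then show "m \<in> X c \<union> B \<union> ?B'"
        using m by (auto simp: X_def)
    qed
    then have "card {..<?n - c} \<le> card (X c \<union> B \<union> ?B')"
      using B by (intro card_mono) (auto simp: X_def)
    also have "\<dots> \<le> card (X c) + card B + card ?B'"
      by (rule order.trans[OF card_Un_le add_mono[OF card_Un_le order.refl]])
    also have "\<dots> \<le> card (X c) + 2 * card B"
      using card_image_le[OF B(1), of "\<lambda>m. m - c"] by simp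
    finally have "?n \<le> card (X c) + 2 * card B + c"
      by simp
    moreover have "c < 2 * L"
      using c by simp
    ultimately show ?thesis
      using B(2) length_ge[OF j] by linarith
  qed
  define nd where "nd = the_inv_into (N j) (pos j)"
  have nd: "nd m \<in> N j" "pos j (nd m) = m" if "m < ?n" for m
    using pos_bij[OF j] that unfolding nd_def bij_betw_def
    by (auto intro: the_inv_into_into f_the_inv_into_f)
  have nd_good: "nd m \<in> good j" if "m < ?n" "m \<notin> B" for m
    using nd[OF that(1)] that(2) unfolding B_def bad_def by force
  have "card (SIGMA c:{L..<2 * L}. X c) \<le> card (gpairs j)"
  proof (rule card_inj_on_le[of "\<lambda>(c, m). (nd m, nd (m + c))"])
    show "inj_on (\<lambda>(c, m). (nd m, nd (m + c))) (SIGMA c:{L..<2 * L}. X c)"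
    proof (rule inj_onI, clarify)
      fix c m c' m' assume *: "c \<in> {L..<2 * L}" "m \<in> X c" "c' \<in> {L..<2 * L}" "m' \<in> X c'"
        "nd m = nd m'" "nd (m + c) = nd (m' + c')"
      then have "m < ?n" "m' < ?n" "m + c < ?n" "m' + c' < ?n"
        by (auto simp: X_def)
      then have "m = m'" "m + c = m' + c'"
        using nd(2) *(5,6) by metis+
      then show "c = c' \<and> m = m'" by auto
    qed
    show "(\<lambda>(c, m). (nd m, nd (m + c))) ` (SIGMA c:{L..<2 * L}. X c) \<subseteq> gpairs j"
    proof clarify
      fix c m assume *: "c \<in> {L..<2 * L}" "m \<in> X c"
      then have m: "m < ?n" "m + c < ?n" "m \<notin> B" "m + c \<notin> B"
        by (auto simp: X_def)
      show "(nd m, nd (m + c)) \<in> gpairs j"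
        using nd[OF m(1)] nd[OF m(2)] nd_good[OF m(1,3)] nd_good[OF m(2,4)] *(1) j scales(1)
        unfolding gpairs_def lg_def before_def by auto
    qed
  qed (fact fing)
  then have "(\<Sum>c\<in>{L..<2 * L}. card (X c)) \<le> card (gpairs j)"
    by (simp add: X_def)
  moreover have "(\<Sum>c\<in>{L..<2 * L}. ?n) \<le> (\<Sum>c\<in>{L..<2 * L}. 4 * card (X c))"
    by (intro sum_mono X)
  ultimately show "L * ?n \<le> 4 * card (gpairs j)"
    by (simp add: sum_distrib_left[symmetric])
qed

text \<open>The middle step has at least a quarter of \<open>L * card (N j)\<close> choices on each
  path j, and each of the two corners at least d/2, hence the factor 16.\<close>

lemma rungs_ge: "M * L * d\<^sup>2 \<le> 16 * card rungs"
proof -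
  define S where "S = (SIGMA j:I. SIGMA q:gpairs j. {i. corner (fst q) i j} \<times> {k. corner (snd q) j k})"
  have many: "d \<le> 2 * card {i. corner x i j}" "d \<le> 2 * card {i. corner x j i}" if "j \<in> I" "x \<in> good j" for j x
  proof -
    show "d \<le> 2 * card {i. corner x i j}"
      using corner_count_ge[of j x] that d_ge unfolding good_def by auto
    then show "d \<le> 2 * card {i. corner x j i}"
      by (simp add: corner_sym[of x j])
  qed
  have "card S \<le> card rungs"
  proof (rule card_inj_on_le[of "\<lambda>(j, (x, y), (i, k)). (i, x, j, y, k)"])
    show "(\<lambda>(j, (x, y), i, k). (i, x, j, y, k)) ` S \<subseteq> rungs"
      unfolding S_def rungs_def gpairs_def by auto
  qed (auto simp: inj_on_def finite_rungs)
  moreover have "card S = (\<Sum>j\<in>I. \<Sum>q\<in>gpairs j. card {i. corner (fst q) i j} * card {k. corner (snd q) j k})"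
    unfolding S_def using finite_I gpairs_ge(1) corner_count
    by (subst card_SigmaI) (auto simp: card_cartesian_product)
  moreover have "L * card (N j) * d\<^sup>2 \<le> 16 * (\<Sum>q\<in>gpairs j. card {i. corner (fst q) i j} * card {k. corner (snd q) j k})"
    if j: "j \<in> I" for j
  proof -
    have "L * card (N j) * d\<^sup>2 \<le> 4 * card (gpairs j) * d\<^sup>2"
      using gpairs_ge(2)[OF j] by (rule mult_le_mono1)
    also have "\<dots> = 4 * (\<Sum>q\<in>gpairs j. d * d)"
      by (simp add: power2_eq_square)
    also have "\<dots> \<le> 4 * (\<Sum>q\<in>gpairs j. (2 * card {i. corner (fst q) i j}) * (2 * card {k. corner (snd q) j k}))"
      using many[OF j] by (intro mult_le_mono2 sum_mono mult_le_mono) (auto simp: gpairs_def)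
    also have "\<dots> = 16 * (\<Sum>q\<in>gpairs j. card {i. corner (fst q) i j} * card {k. corner (snd q) j k})"
      by (simp add: sum_distrib_left mult_ac)
    finally show ?thesis .
  qed
  then have "(\<Sum>j\<in>I. L * card (N j) * d\<^sup>2) \<le> (\<Sum>j\<in>I. 16 * (\<Sum>q\<in>gpairs j. card {i. corner (fst q) i j} * card {k. corner (snd q) j k}))"
    by (intro sum_mono)
  then have "(\<Sum>j\<in>I. L * card (N j) * d\<^sup>2) \<le> 16 * (\<Sum>j\<in>I. \<Sum>q\<in>gpairs j. card {i. corner (fst q) i j} * card {k. corner (snd q) j k})"
    by (simp only: sum_distrib_left[symmetric])
  moreover have "M * L * d\<^sup>2 = (\<Sum>j\<in>I. L * card (N j) * d\<^sup>2)"
    unfolding M_def sum_distrib_right by (simp add: mult_ac)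
  ultimately show ?thesis
    by linarith
qed

text \<open>Cauchy-Schwarz over the keys bounds the square of \<open>card rungs\<close> by the
  number of keys times \<open>card rungs + 2 * card AB\<close>. If the first summand is absorbed on
  the left, diamonds dominate, and \<open>bound\<close> can be compared with
  \<open>rungs_ge\<close>.\<close>

lemma scale_inequality:
  assumes "I \<noteq> {}" "96 * card I \<le> s * L * d\<^sup>2"
  shows "L ^ 3 * d ^ 4 \<le> 3072 * card I * (10 * d * L\<^sup>2 + s * card I)"
proof -
  let ?R = "card rungs" and ?p = "card I"
  obtain i where i: "i \<in> I" using assms by blast
  have "0 < card (N i)"
    using length_ge[OF i] scales(1) by linarith
  then have M: "0 < M"
    unfolding M_def using finite_I i by (simp add: sum_pos2)
  obtain T where T: "finite T" "key ` rungs \<subseteq> T" "s * card T \<le> 3 * ?p * M"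
    using keys_le by blast
  have "?R\<^sup>2 \<le> card T * (?R + 2 * card AB)"
    using card_squared_le_key_pairs[OF finite_rungs T(1,2)] rung_key_pairs_le
    by (rule_tac order.trans[OF _ mult_le_mono2])
  then have "s * ?R\<^sup>2 \<le> (s * card T) * (?R + 2 * card AB)"
    unfolding mult.assoc by (rule mult_le_mono2)
  also have "\<dots> \<le> (3 * ?p * M) * (?R + 2 * card AB)"
    using T(3) by (rule mult_le_mono1)
  finally have 1: "s * ?R\<^sup>2 \<le> (3 * ?p * M) * ?R + 6 * ?p * M * card AB"
    by (simp add: distrib_left)
  \<comment> \<open>Here 96 = 6 * 16, with 16 from \<open>rungs_ge\<close>. The result
    \<open>6 * (?p * M) \<le> s * ?R\<close> makes the term of the identical rungs at most half of
    the left side.\<close>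
  have "96 * (?p * M) \<le> s * (M * L * d\<^sup>2)"
    using mult_le_mono1[OF assms(2), of M] by (simp add: mult_ac)
  also have "\<dots> \<le> s * (16 * ?R)"
    using rungs_ge by (rule mult_le_mono2)
  finally have "6 * (?p * M) \<le> s * ?R" by simp
  then have "2 * ((3 * ?p * M) * ?R) \<le> s * ?R\<^sup>2"
    using mult_le_mono1[of "6 * (?p * M)" "s * ?R" ?R] by (simp add: power2_eq_square mult_ac)
  then have 2: "s * ?R\<^sup>2 \<le> 12 * ?p * M * card AB"
    using 1 by linarith
  have "s * (L * ?R\<^sup>2) \<le> 12 * ?p * M * (L * card AB)"
    using mult_le_mono2[OF 2, of L] by (simp add: mult_ac)
  also have "\<dots> \<le> 12 * ?p * M * bound"
    using AB(2) by (rule mult_le_mono2)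
  also have "\<dots> = s * (12 * ?p * M\<^sup>2 * (10 * d * L\<^sup>2 + s * ?p))"
    unfolding bound_def by (simp add: algebra_simps power2_eq_square)
  finally have 3: "L * ?R\<^sup>2 \<le> 12 * ?p * M\<^sup>2 * (10 * d * L\<^sup>2 + s * ?p)"
    using scales(2) by simp
  have "(M * L * d\<^sup>2)\<^sup>2 \<le> (16 * ?R)\<^sup>2"
    using rungs_ge by (rule power_mono) simp
  then have "L * (M * L * d\<^sup>2)\<^sup>2 \<le> 256 * (L * ?R\<^sup>2)"
    using mult_le_mono2[of "(M * L * d\<^sup>2)\<^sup>2" "(16 * ?R)\<^sup>2" L] by (simp add: power_mult_distrib mult_ac)
  also have "\<dots> \<le> 256 * (12 * ?p * M\<^sup>2 * (10 * d * L\<^sup>2 + s * ?p))"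
    using 3 by (rule mult_le_mono2)
  also have "L * (M * L * d\<^sup>2)\<^sup>2 = M\<^sup>2 * (L ^ 3 * d ^ 4)"
    by (simp add: power2_eq_square power3_eq_cube power4_eq_xxxx mult_ac)
  also have "256 * (12 * ?p * M\<^sup>2 * (10 * d * L\<^sup>2 + s * ?p)) = M\<^sup>2 * (3072 * ?p * (10 * d * L\<^sup>2 + s * ?p))"
    by (simp add: mult_ac)
  finally show ?thesis
    using M by simp
qed

end

section \<open>Passing to a dense subfamily\<close>

text \<open>A maximiser of incidences minus \<open>\<delta>\<close> per node minus \<open>m\<close> per path has the required minimum degrees.\<close>

lemma exists_dense_subfamily:
  fixes T :: "'i \<Rightarrow> 'a set" and \<delta> m :: nat
  assumes fin: "finite V" "finite I" and T: "\<And>i. i \<in> I \<Longrightarrow> T i \<subseteq> V"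
    and large: "card V * \<delta> + card I * m < (\<Sum>i\<in>I. card (T i))"
  shows "\<exists>W J. W \<subseteq> V \<and> J \<subseteq> I \<and> J \<noteq> {} \<and> (\<forall>i\<in>J. m \<le> card (T i \<inter> W)) \<and> (\<forall>x\<in>W. \<delta> \<le> card {i\<in>J. x \<in> T i})"
proof -
  define \<Phi> :: "'a set \<times> 'i set \<Rightarrow> int"
    where "\<Phi> = (\<lambda>(W, J). (\<Sum>i\<in>J. int (card (T i \<inter> W))) - int \<delta> * int (card W) - int m * int (card J))"
  let ?S = "Pow V \<times> Pow I"
  have S: "finite ?S" "?S \<noteq> {}"
    using fin by auto
  then have "Max (\<Phi> ` ?S) \<in> \<Phi> ` ?S"
    by simp
  then obtain W J where WJ: "W \<subseteq> V" "J \<subseteq> I" "\<Phi> (W, J) = Max (\<Phi> ` ?S)"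
    by auto
  have max: "\<Phi> (W', J') \<le> \<Phi> (W, J)" if "W' \<subseteq> V" "J' \<subseteq> I" for W' J'
    unfolding WJ(3) using S(1) that by (intro Max_ge) auto
  have finWJ: "finite W" "finite J"
    using WJ fin finite_subset by blast+
  have "(\<Sum>i\<in>I. card (T i \<inter> V)) = (\<Sum>i\<in>I. card (T i))"
    using T by (intro sum.cong) (auto simp: Int_absorb2)
  then have "\<Phi> (V, I) = int (\<Sum>i\<in>I. card (T i)) - int (card V * \<delta> + card I * m)"
    unfolding \<Phi>_def by (simp flip: of_nat_sum)
  \<comment> \<open>Without paths the functional is never positive, so a positive maximum forces J
    to be nonempty.\<close>
  then have "0 < \<Phi> (W, J)"
    using max[OF order.refl order.refl] large by linarith
  then have "J \<noteq> {}"
    unfolding \<Phi>_def by (auto simp: mult_less_0_iff zero_less_mult_iff)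
  moreover have "m \<le> card (T i \<inter> W)" if i: "i \<in> J" for i
  proof -
    have "\<Phi> (W, J - {i}) = \<Phi> (W, J) - int (card (T i \<inter> W)) + int m"
    proof -
      have "int (card J) = int (card (J - {i})) + 1"
        using card_Suc_Diff1[OF finWJ(2) i] by linarith
      moreover have "(\<Sum>j\<in>J - {i}. int (card (T j \<inter> W))) = (\<Sum>j\<in>J. int (card (T j \<inter> W))) - int (card (T i \<inter> W))"
        using finWJ i by (simp add: sum_diff1)
      ultimately show ?thesis
        unfolding \<Phi>_def by (simp only: prod.case algebra_simps)
    qed
    then show ?thesis
      using max[of W "J - {i}"] WJ by fastforce
  qed
  moreover have "\<delta> \<le> card {i\<in>J. x \<in> T i}" if x: "x \<in> W" for x
  proof -
    have swap: "(\<Sum>i\<in>J. card (T i \<inter> U)) = (\<Sum>y\<in>U. card {i\<in>J. y \<in> T i})" if "finite U" for U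
    proof -
      have "(\<Sum>i\<in>J. card {y\<in>U. y \<in> T i}) = (\<Sum>y\<in>U. card {i\<in>J. y \<in> T i})"
        by (rule sum_multicount_gen[OF finWJ(2) that]) simp
      then show ?thesis
        by (simp add: Int_def conj_commute)
    qed
    have "(\<Sum>i\<in>J. card (T i \<inter> W)) = (\<Sum>i\<in>J. card (T i \<inter> (W - {x}))) + card {i\<in>J. x \<in> T i}"
      using finWJ x by (simp add: swap sum.remove)
    then have "(\<Sum>i\<in>J. int (card (T i \<inter> W))) = (\<Sum>i\<in>J. int (card (T i \<inter> (W - {x})))) + int (card {i\<in>J. x \<in> T i})"
      by (simp only: of_nat_add[symmetric] of_nat_sum[symmetric])
    moreover have "int (card W) = int (card (W - {x})) + 1"
      using card_Suc_Diff1[OF finWJ(1) x] by linarith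
    ultimately have "\<Phi> (W - {x}, J) = \<Phi> (W, J) - int (card {i\<in>J. x \<in> T i}) + int \<delta>"
      unfolding \<Phi>_def by (simp only: prod.case algebra_simps)
    then show ?thesis
      using max[of "W - {x}" J] WJ by fastforce
  qed
  ultimately show ?thesis
    using WJ by blast
qed

text \<open>Each path is first halved to limit its reversals, which the factor 2 in
  \<open>size\<close> pays for. Then a subfamily of large minimum degree and length is taken and
  re-ranked, and its nodes are split by labels.\<close>

lemma (in bridge_free_family) family_inequality:
  assumes V: "finite V" "\<And>i. i \<in> I \<Longrightarrow> N i \<subseteq> V"
    and size: "2 * (card V * d + card I * (4 * L)) < (\<Sum>i\<in>I. card (N i))"
    and par: "34 \<le> d" "0 < L" "0 < s" "s \<le> 4 * L" and enough: "96 * card I \<le> s * L * d\<^sup>2"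
  shows "L ^ 3 * d ^ 4 \<le> 3072 * card I * (10 * d * L\<^sup>2 + s * card I)"
proof -
  have "\<forall>i\<in>I. \<exists>T. T \<subseteq> N i \<and> card (N i) \<le> 2 * card T \<and> (\<forall>x\<in>T. card (dn T i x) \<le> 1)"
    using exists_half_with_few_reversals by blast
  from bchoice[OF this] obtain T where
    T: "\<And>i. i \<in> I \<Longrightarrow> T i \<subseteq> N i \<and> card (N i) \<le> 2 * card (T i) \<and> (\<forall>x\<in>T i. card (dn (T i) i x) \<le> 1)"
    by blast
  have TV: "T i \<subseteq> V" if "i \<in> I" for i
    using T[OF that] V(2)[OF that] by blast
  have "(\<Sum>i\<in>I. card (N i)) \<le> (\<Sum>i\<in>I. 2 * card (T i))"
    using T by (intro sum_mono) auto
  then have large: "card V * d + card I * (4 * L) < (\<Sum>i\<in>I. card (T i))"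
    using size by (simp add: sum_distrib_left[symmetric])
  obtain W J where dense: "W \<subseteq> V \<and> J \<subseteq> I \<and> J \<noteq> {} \<and> (\<forall>i\<in>J. 4 * L \<le> card (T i \<inter> W)) \<and> (\<forall>x\<in>W. d \<le> card {i\<in>J. x \<in> T i})"
    using exists_dense_subfamily[OF V(1) finite_I _ large] TV by auto
  then have WJ: "W \<subseteq> V" "J \<subseteq> I" "J \<noteq> {}" "\<And>i. i \<in> J \<Longrightarrow> 4 * L \<le> card (T i \<inter> W)"
    "\<And>x. x \<in> W \<Longrightarrow> d \<le> card {i\<in>J. x \<in> T i}"
    by auto
  define U where "U i = T i \<inter> W" for i
  define rk where "rk i x = card {z\<in>U i. pos i z < pos i x}" for i x
  have UN: "U i \<subseteq> N i" if "i \<in> J" for i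
    using T[of i] WJ(2) that unfolding U_def by auto
  have rk_eq: "rk = (\<lambda>i x. card {z\<in>U i. pos i z < pos i x})"
    by (simp add: rk_def fun_eq_iff)
  interpret F: bridge_free_family J U rk
    unfolding rk_eq by (rule restrict(1)[OF WJ(2) UN])
  have rk: "rk i x < rk i y \<longleftrightarrow> pos i x < pos i y" if "i \<in> J" "x \<in> U i" "y \<in> U i" for i x y
    unfolding rk_eq by (rule restrict(2)[OF WJ(2) UN that])
  have multi: "(\<Sum>x\<in>U i. card (F.multi i x)) \<le> 2 * card (U i)" if i: "i \<in> J" for i
  proof (rule F.sum_multi_le[OF i])
    fix x assume x: "x \<in> U i"
    have iI: "i \<in> I" using i WJ(2) by blast
    \<comment> \<open>Ranks preserve the order on each path, so deleting nodes and paths only loses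
      reversals.\<close>
    have "F.dn (U i) i x \<subseteq> dn (T i) i x"
    proof
      fix j assume "j \<in> F.dn (U i) i x"
      then obtain y where j: "j \<in> J" "j \<noteq> i" "x \<in> U j" "y \<in> U i" "y \<in> U j" "rk i y < rk i x"
        unfolding F.dn_def by auto
      then have "pos i y < pos i x"
        using rk[OF i _ x] by blast
      moreover have "x \<in> N j" "y \<in> N j" "y \<in> T i" "j \<in> I"
        using j UN[of j] WJ(2) unfolding U_def by auto
      ultimately show "j \<in> dn (T i) i x"
        unfolding dn_def using j(2) by auto
    qed
    then have "card (F.dn (U i) i x) \<le> card (dn (T i) i x)"
      using finite_I by (intro card_mono) (auto simp: dn_def)
    then show "card (F.dn (U i) i x) \<le> 1"
      using T[OF iI] x unfolding U_def by fastforce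
  qed
  have "\<forall>x. \<exists>f::'i \<Rightarrow> nat. \<forall>i\<in>{i\<in>J. x \<in> U i}. d \<le> card {j\<in>{i\<in>J. x \<in> U i}. f j = f i} \<and> card {j\<in>{i\<in>J. x \<in> U i}. f j = f i} \<le> 2 * d"
  proof
    fix x
    show "\<exists>f::'i \<Rightarrow> nat. \<forall>i\<in>{i\<in>J. x \<in> U i}. d \<le> card {j\<in>{i\<in>J. x \<in> U i}. f j = f i} \<and> card {j\<in>{i\<in>J. x \<in> U i}. f j = f i} \<le> 2 * d"
    proof (cases "x \<in> W")
      case True
      then show ?thesis
        using WJ(5)[OF True] F.finite_I par(1) by (intro balanced_partition) (auto simp: U_def)
    qed (auto simp: U_def)
  qed
  from choice[OF this] obtain g :: "'a \<Rightarrow> 'i \<Rightarrow> nat" where g: "\<And>x. \<forall>i\<in>{i\<in>J. x \<in> U i}.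
      d \<le> card {j\<in>{i\<in>J. x \<in> U i}. g x j = g x i} \<and> card {j\<in>{i\<in>J. x \<in> U i}. g x j = g x i} \<le> 2 * d"
    by blast
  interpret G: scaled_dense_family J U rk g d L s
  proof
    show "(\<Sum>x\<in>U i. card (F.multi i x)) \<le> 2 * card (U i)" if "i \<in> J" for i
      using multi that .
    show "d \<le> card {j\<in>J. x \<in> U j \<and> g x j = g x i}" "card {j\<in>J. x \<in> U j \<and> g x j = g x i} \<le> 2 * d"
      if "i \<in> J" "x \<in> U i" for i x
      using g[of x] that by (auto simp: conj_assoc)
    show "4 * L \<le> card (U i)" if "i \<in> J" for i
      using WJ(4) that unfolding U_def .
  qed (use par in auto)
  \<comment> \<open>The final bound grows with the number of paths, so it passes from J back to
    I.\<close>
  have le: "card J \<le> card I"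
    using WJ(2) finite_I by (rule card_mono[rotated])
  have "L ^ 3 * d ^ 4 \<le> 3072 * card J * (10 * d * L\<^sup>2 + s * card J)"
    using G.scale_inequality WJ(3) enough le by linarith
  also have "\<dots> \<le> 3072 * card I * (10 * d * L\<^sup>2 + s * card I)"
    using le by (intro mult_le_mono add_le_mono) auto
  finally show ?thesis .
qed

section \<open>Bridge girth of lists of paths\<close>

lemma no_bridge_of_girth:
  assumes "enat k < bridge_girth Ps" "b \<le> k"
  shows "\<not> has_bridge Ps b"
proof
  assume b: "has_bridge Ps b"
  then have "bridge_girth Ps = enat (LEAST b. has_bridge Ps b)"
    unfolding bridge_girth_def by auto
  moreover have "(LEAST b. has_bridge Ps b) \<le> b"
    using b by (rule Least_le)
  ultimately show False
    using assms by (simp flip: enat_ord_simps)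
qed

lemma has_bridgeI:
  assumes "length v = b" "length f = b" "distinct v" "distinct f" "0 < b" "\<And>i. i < b \<Longrightarrow> f ! i < length Ps"
    "\<And>i. i + 1 < b \<Longrightarrow> precedes (Ps ! (f ! i)) (v ! i) (v ! (i + 1))"
    "precedes (Ps ! (f ! (b - 1))) (v ! 0) (v ! (b - 1))"
  shows "has_bridge Ps b"
  unfolding has_bridge_def using assms
  by (intro conjI exI[of _ "(!) v"] exI[of _ "(!) f"]) (auto intro: inj_on_nth)

lemma bridge_free_family_of_paths:
  assumes ps: "path_system V Ps" and girth: "enat 4 < bridge_girth Ps"
  defines "pos \<equiv> \<lambda>i. the_inv_into {..<length (Ps ! i)} ((!) (Ps ! i))"
  shows "bridge_free_family {..<length Ps} (\<lambda>i. set (Ps ! i)) pos"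
proof -
  have dist: "distinct (Ps ! i)" if "i < length Ps" for i
    using ps that unfolding path_system_def by auto
  have bij: "bij_betw (pos i) (set (Ps ! i)) {..<length (Ps ! i)}" if "i < length Ps" for i
    unfolding pos_def using bij_betw_nth[OF dist[OF that]] by (intro bij_betw_the_inv_into) auto
  have nth_pos: "Ps ! i ! pos i x = x" if "i < length Ps" "x \<in> set (Ps ! i)" for i x
    unfolding pos_def using bij_betw_nth[OF dist[OF that(1)] refl refl] that(2)
    by (auto simp: bij_betw_def intro: f_the_inv_into_f)
  have prec: "precedes (Ps ! i) x y" if "before (\<lambda>i. set (Ps ! i)) pos i x y" "i < length Ps" for i x y
    using that nth_pos[of i x] nth_pos[of i y] bij_betwE[OF bij[of i]]
    unfolding before_def precedes_def by (intro exI[of _ "pos i x"] exI[of _ "pos i y"]) auto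
  note noB = no_bridge_of_girth[OF girth]
  have ne: "x \<noteq> y" if "before (\<lambda>i. set (Ps ! i)) pos i x y" for i x y
    using that by (auto simp: before_def)
  have no2: "i = j" if "i < length Ps" "j < length Ps" "before (\<lambda>i. set (Ps ! i)) pos i x y"
    "before (\<lambda>i. set (Ps ! i)) pos j x y" for i j x y
  proof (rule ccontr)
    assume "i \<noteq> j"
    then have "has_bridge Ps 2"
      using that prec ne[OF that(3)]
      by (intro has_bridgeI[of "[x, y]" _ "[i, j]"]) (auto simp: less_Suc_eq numeral_2_eq_2)
    then show False using noB[of 2] by simp
  qed
  show ?thesis
  proof
    show "bij_betw (pos i) (set (Ps ! i)) {..<card (set (Ps ! i))}" if "i \<in> {..<length Ps}" for i
      using bij[of i] dist[of i] that by (simp add: distinct_card)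
    show "i = j" if "i \<in> {..<length Ps}" "j \<in> {..<length Ps}" "before (\<lambda>i. set (Ps ! i)) pos i x y"
      "before (\<lambda>i. set (Ps ! i)) pos j x y" for i j x y
      using no2 that by auto
  next
    fix i j k x y z
    assume *: "i \<in> {..<length Ps}" "j \<in> {..<length Ps}" "k \<in> {..<length Ps}"
      "before (\<lambda>i. set (Ps ! i)) pos i x y" "before (\<lambda>i. set (Ps ! i)) pos j y z" "before (\<lambda>i. set (Ps ! i)) pos k x z"
    show "\<not> distinct [i, j, k]"
    proof
      assume "distinct [i, j, k]"
      then have "has_bridge Ps 3"
        using * prec ne[OF *(4)] ne[OF *(5)] ne[OF *(6)]
        by (intro has_bridgeI[of "[x, y, z]" _ "[i, j, k]"]) (auto simp: less_Suc_eq numeral_3_eq_3)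
      then show False using noB[of 3] by simp
    qed
  next
    fix i j k l x y z w
    assume *: "i \<in> {..<length Ps}" "j \<in> {..<length Ps}" "k \<in> {..<length Ps}" "l \<in> {..<length Ps}"
      "before (\<lambda>i. set (Ps ! i)) pos i x y" "before (\<lambda>i. set (Ps ! i)) pos j y z"
      "before (\<lambda>i. set (Ps ! i)) pos k z w" "before (\<lambda>i. set (Ps ! i)) pos l x w"
    show "\<not> distinct [i, j, k, l]"
    proof
      assume d: "distinct [i, j, k, l]"
      \<comment> \<open>A bridge needs distinct nodes. If x = z, the paths k and l would form a
        2-bridge; if y = w, the paths i and l would.\<close>
      have "x \<noteq> z"
        using no2[of k l x w] * d by auto
      moreover have "y \<noteq> w"
        using no2[of i l x w] * d by auto
      ultimately have "has_bridge Ps 4"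
        using * d prec ne[OF *(5)] ne[OF *(6)] ne[OF *(7)] ne[OF *(8)]
        by (intro has_bridgeI[of "[x, y, z, w]" _ "[i, j, k, l]"]) (auto simp: less_Suc_eq eval_nat_numeral)
      then show False using noB[of 4] by simp
    qed
  qed auto
qed

lemma ps_size_eq_sum:
  assumes "path_system V Ps"
  shows "ps_size Ps = (\<Sum>i<length Ps. card (set (Ps ! i)))"
proof -
  have "ps_size Ps = (\<Sum>i<length Ps. length (Ps ! i))"
    unfolding ps_size_def by (simp add: sum_list_sum_nth atLeast0LessThan)
  also have "\<dots> = (\<Sum>i<length Ps. card (set (Ps ! i)))"
    using assms unfolding path_system_def by (intro sum.cong) (auto simp: distinct_card)
  finally show ?thesis .
qed

text \<open>The sizes form a finite nonempty set, so \<open>Max\<close> in \<open>beta\<close> is a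
  true maximum: they are at most p * n, and p empty paths have no bridge because the closing path of
  a bridge contains nodes.\<close>

lemma beta_attained:
  assumes "0 < n"
  shows "\<exists>V Ps. path_system (V::nat set) Ps \<and> card V = n \<and> length Ps = p \<and> enat k < bridge_girth Ps \<and> beta n p k = ps_size Ps"
proof -
  let ?S = "{ps_size Ps | (V::nat set) Ps. path_system V Ps \<and> card V = n \<and> length Ps = p \<and> bridge_girth Ps > enat k}"
  have "?S \<subseteq> {..p * n}"
  proof clarify
    fix V :: "nat set" and Ps assume *: "path_system V Ps" "n = card V" "p = length Ps"
    have "ps_size Ps = (\<Sum>i<length Ps. card (set (Ps ! i)))"
      using ps_size_eq_sum[OF *(1)] .
    also have "\<dots> \<le> (\<Sum>i<length Ps. card V)"
      using *(1) unfolding path_system_def by (intro sum_mono card_mono) auto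
    finally show "ps_size Ps \<le> length Ps * card V"
      by simp
  qed
  then have "finite ?S"
    using finite_subset by blast
  moreover have "?S \<noteq> {}"
  proof -
    let ?Ps = "replicate p ([]::nat list)"
    have "\<not> has_bridge ?Ps b" for b
      unfolding has_bridge_def precedes_def by (auto dest!: spec[of _ "b - 1"])
    then have "bridge_girth ?Ps = \<infinity>"
      unfolding bridge_girth_def by simp
    then have "path_system {..<n} ?Ps \<and> card {..<n} = n \<and> length ?Ps = p \<and> bridge_girth ?Ps > enat k"
      unfolding path_system_def by auto
    then show ?thesis by blast
  qed
  ultimately have "beta n p k \<in> ?S"
    unfolding beta_def by (rule Max_in)
  then show ?thesis by blast
qed

section \<open>Choice of the short scale and the resulting exponents\<close>

lemma two_regimes:
  fixes d L p :: nat
  assumes "34 \<le> d" "0 < L" "0 < p"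
    and ineq: "\<And>s. \<lbrakk>0 < s; s \<le> 4 * L; 96 * p \<le> s * L * d\<^sup>2\<rbrakk> \<Longrightarrow> L ^ 3 * d ^ 4 \<le> 3072 * p * (10 * d * L\<^sup>2 + s * p)"
  shows "L * d ^ 3 \<le> 92160 * p \<or> L ^ 4 * d ^ 6 \<le> 884736 * p ^ 3"
proof -
  let ?q = "L * d\<^sup>2"
  have cancel: "a \<le> b" if "k * a \<le> k * b" "0 < k" for a b k :: nat
    using that by simp
  \<comment> \<open>Up to rounding, this is the least \<open>s\<close> that satisfies the lower
    bound required in \<open>ineq\<close>.\<close>
  define s where "s = 96 * p div ?q + 1"
  have q: "0 < ?q" using assms by simp
  have "96 * p < s * ?q"
    unfolding s_def using dividend_less_div_times[OF q, of "96 * p"] by (simp add: algebra_simps)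
  then have enough: "96 * p \<le> s * L * d\<^sup>2"
    by (simp add: mult.assoc)
  have s_le: "s * ?q \<le> 96 * p + ?q"
    unfolding s_def using div_times_less_eq_dividend[of "96 * p" ?q] by (simp add: algebra_simps)
  show ?thesis
  proof (cases "s \<le> 4 * L")
    case False
    \<comment> \<open>If this \<open>s\<close> exceeds \<open>4 * L\<close>, then (L d)^2 \<le> 24
      p, and its cube is stronger than the second alternative.\<close>
    then have "4 * L * ?q \<le> 96 * p div ?q * ?q"
      unfolding s_def by (intro mult_le_mono1) simp
    also have "\<dots> \<le> 96 * p"
      by (rule div_times_less_eq_dividend)
    finally have "(L * d)\<^sup>2 \<le> 24 * p"
      by (simp add: power2_eq_square mult_ac)
    then have "((L * d)\<^sup>2) ^ 3 \<le> (24 * p) ^ 3"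
      by (rule power_mono) simp
    then have "L\<^sup>2 * (L ^ 4 * d ^ 6) \<le> 13824 * p ^ 3"
      by (simp add: power_mult_distrib flip: power_mult power_add mult.assoc)
    moreover have "1 * (L ^ 4 * d ^ 6) \<le> L\<^sup>2 * (L ^ 4 * d ^ 6)"
      using assms by (intro mult_le_mono1) (simp add: Suc_le_eq)
    ultimately show ?thesis by linarith
  next
    case True
    have "L ^ 3 * d ^ 4 \<le> 3072 * p * (10 * d * L\<^sup>2 + s * p)"
      using ineq[OF _ True enough] unfolding s_def by simp
    then have "L ^ 3 * d ^ 4 * ?q \<le> 3072 * p * (10 * d * L\<^sup>2 + s * p) * ?q"
      by (rule mult_le_mono1)
    also have "\<dots> = 30720 * p * d * L\<^sup>2 * ?q + 3072 * p\<^sup>2 * (s * ?q)"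
      by (simp add: algebra_simps power2_eq_square)
    also have "\<dots> \<le> 30720 * p * d * L\<^sup>2 * ?q + 3072 * p\<^sup>2 * (96 * p + ?q)"
      using s_le by (intro add_left_mono mult_le_mono2)
    finally have main: "L ^ 3 * d ^ 4 * ?q \<le> 30720 * p * d * L\<^sup>2 * ?q + 294912 * p ^ 3 + 3072 * p\<^sup>2 * ?q"
      by (simp add: algebra_simps power2_eq_square power3_eq_cube)
    consider "L ^ 3 * d ^ 4 * ?q \<le> 3 * (30720 * p * d * L\<^sup>2 * ?q)" | "L ^ 3 * d ^ 4 * ?q \<le> 3 * (294912 * p ^ 3)"
      | "L ^ 3 * d ^ 4 * ?q \<le> 3 * (3072 * p\<^sup>2 * ?q)"
      using main by linarith
    then show ?thesis
    proof cases
      case 1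
      moreover have "L ^ 3 * d ^ 4 * ?q = ?q * (d * L\<^sup>2) * (L * d ^ 3)"
        by (simp add: power2_eq_square power3_eq_cube power4_eq_xxxx)
      moreover have "3 * (30720 * p * d * L\<^sup>2 * ?q) = ?q * (d * L\<^sup>2) * (92160 * p)"
        by (simp add: power2_eq_square)
      ultimately have "?q * (d * L\<^sup>2) * (L * d ^ 3) \<le> ?q * (d * L\<^sup>2) * (92160 * p)"
        by (simp only:)
      then have "L * d ^ 3 \<le> 92160 * p"
        by (rule cancel) (use assms in simp)
      then show ?thesis ..
    next
      case 2
      moreover have "L ^ 3 * d ^ 4 * ?q = L ^ 4 * d ^ 6"
        by (simp add: eval_nat_numeral)
      ultimately have "L ^ 4 * d ^ 6 \<le> 884736 * p ^ 3"
        by linarith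
      then show ?thesis ..
    next
      case 3
      then have "?q * (L ^ 3 * d ^ 4) \<le> ?q * (9216 * p\<^sup>2)"
        by (simp only: mult_ac)
      then have "L ^ 3 * d ^ 4 \<le> 9216 * p\<^sup>2"
        by (rule cancel[OF _ q])
      \<comment> \<open>The left side is L times the square of L^4 d^6, and 9216^3 = 884736^2, so
        this case also ends in the second alternative.\<close>
      then have "(L ^ 3 * d ^ 4) ^ 3 \<le> (9216 * p\<^sup>2) ^ 3"
        by (rule power_mono) simp
      moreover have "(L ^ 3 * d ^ 4) ^ 3 = L * (L ^ 4 * d ^ 6)\<^sup>2"
        by (simp add: power_mult_distrib flip: power_mult power_Suc mult.assoc)
      moreover have "(9216 * p\<^sup>2) ^ 3 = (884736 * p ^ 3)\<^sup>2"
        by (simp add: power_mult_distrib flip: power_mult)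
      moreover have "1 * (L ^ 4 * d ^ 6)\<^sup>2 \<le> L * (L ^ 4 * d ^ 6)\<^sup>2"
        using assms by (intro mult_le_mono1) simp
      ultimately have "(L ^ 4 * d ^ 6)\<^sup>2 \<le> (884736 * p ^ 3)\<^sup>2"
        by linarith
      then have "L ^ 4 * d ^ 6 \<le> 884736 * p ^ 3"
        by (rule power2_le_imp_le) simp
      then show ?thesis ..
    qed
  qed
qed

lemma div_ge_half:
  assumes "0 < m div k"
  shows "real m / (2 * real k) \<le> real (m div k)"
proof -
  have "0 < k" using assms by (metis bot_nat_0.not_eq_extremum div_by_0)
  have "k * 1 \<le> k * (m div k)"
    using assms by (intro mult_le_mono2) simp
  moreover have "m < k * (m div k) + k"
    using \<open>0 < k\<close> by (metis dividend_less_times_div add.commute)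
  ultimately have "m \<le> 2 * k * (m div k)"
    by linarith
  then have "real m \<le> real (2 * k * (m div k))"
    by (simp only: of_nat_le_iff)
  then show ?thesis
    using \<open>0 < k\<close> by (simp add: field_simps)
qed

text \<open>The left side is what m^10 = O(n^6 p^7) yields. For p \<le> n^2 the factor p^(1/80) is
  at most n^(1/40), which leads to the first term; otherwise n^(3/5) is at most p^(3/10), which
  leads to p.\<close>

lemma powr_mix_le:
  fixes n p :: real
  assumes "0 < n" "0 < p"
  shows "n powr (3/5) * p powr (7/10) \<le> n powr (5/8) * p powr (11/16) + p"
proof (cases "p \<le> n\<^sup>2")
  case True
  have "p powr (1/80) \<le> (n\<^sup>2) powr (1/80)"
    using True assms by (intro powr_mono2) auto
  also have "(n\<^sup>2) powr (1/80) = n powr (1/40)"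
    using assms by (simp add: powr_powr flip: powr_numeral)
  finally have "p powr (11/16) * p powr (1/80) \<le> p powr (11/16) * n powr (1/40)"
    by (rule mult_left_mono) simp
  moreover have "p powr (7/10) = p powr (11/16) * p powr (1/80)"
    by (simp flip: powr_add)
  ultimately have "n powr (3/5) * p powr (7/10) \<le> n powr (3/5) * (p powr (11/16) * n powr (1/40))"
    by (intro mult_left_mono) auto
  also have "\<dots> = n powr (5/8) * p powr (11/16)"
    by (simp add: mult.left_commute flip: powr_add) 
  finally show ?thesis
    using assms by linarith
next
  case False
  then have "(n\<^sup>2) powr (3/10) \<le> p powr (3/10)"
    using assms by (intro powr_mono2) auto
  moreover have "(n\<^sup>2) powr (3/10) = n powr (3/5)"
    using assms by (simp add: powr_powr flip: powr_numeral)
  ultimately have "n powr (3/5) * p powr (7/10) \<le> p powr (3/10) * p powr (7/10)"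
    by (intro mult_right_mono) auto
  also have "\<dots> = p"
    using assms by (simp flip: powr_add)
  finally show ?thesis
    by (simp add: add_increasing)
qed

lemma path_system_size_le:
  assumes ps: "path_system V Ps" and girth: "enat 4 < bridge_girth Ps" and pos: "0 < card V" "0 < length Ps"
  defines "n \<equiv> real (card V)" and "p \<equiv> real (length Ps)"
  shows "real (ps_size Ps) \<le> 1000 * (n powr (3/4) * p powr (1/2) + n powr (5/8) * p powr (11/16) + n + p)"
proof -
  define m where "m = ps_size Ps"
  \<comment> \<open>With these fractions of average degree and average length, \<open>size\<close>
    in \<open>family_inequality\<close> needs only m/2 < m. If d < 34 or L = 0, then m = O(n) or m =
    O(p) at once.\<close>
  define d where "d = m div (8 * card V)"
  define L where "L = m div (32 * length Ps)"
  have np: "0 < n" "0 < p"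
    using pos by (auto simp: n_def p_def)
  have pw: "0 \<le> n powr (3/4) * p powr (1/2)" "0 \<le> n powr (5/8) * p powr (11/16)"
    by auto
  interpret bridge_free_family "{..<length Ps}" "\<lambda>i. set (Ps ! i)" "\<lambda>i. the_inv_into {..<length (Ps ! i)} ((!) (Ps ! i))"
    by (rule bridge_free_family_of_paths[OF ps girth])
  consider "d < 34" | "L = 0" | "34 \<le> d" "0 < L"
    by linarith
  then have "real m \<le> 1000 * (n powr (3/4) * p powr (1/2) + n powr (5/8) * p powr (11/16) + n + p)"
  proof cases
    case 1
    then have "m < 34 * (8 * card V)"
      unfolding d_def using pos(1) by (simp add: div_less_iff_less_mult)
    then have "real m \<le> 272 * n"
      unfolding n_def by linarith
    then show ?thesis
      using pw np by argo
  next
    case 2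
    then have "m < 32 * length Ps"
      unfolding L_def using pos(2) by (simp add: div_eq_0_iff)
    then have "real m \<le> 32 * p"
      unfolding p_def by linarith
    then show ?thesis
      using pw np by argo
  next
    case 3
    have "0 < m"
      using 3(2) unfolding L_def by (cases "m = 0") auto
    have size: "2 * (card V * d + card {..<length Ps} * (4 * L)) < (\<Sum>i<length Ps. card (set (Ps ! i)))"
    proof -
      have "8 * card V * d \<le> m" "32 * length Ps * L \<le> m"
        unfolding d_def L_def by (rule times_div_less_eq_dividend)+
      then have "2 * (card V * d + card {..<length Ps} * (4 * L)) < m"
        using \<open>0 < m\<close> by simp
      then show ?thesis
        unfolding m_def ps_size_eq_sum[OF ps] .
    qed
    have sub: "finite V" "\<And>i. i \<in> {..<length Ps} \<Longrightarrow> set (Ps ! i) \<subseteq> V"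
      using ps unfolding path_system_def by auto
    have "L ^ 3 * d ^ 4 \<le> 3072 * length Ps * (10 * d * L\<^sup>2 + s * length Ps)"
      if "0 < s" "s \<le> 4 * L" "96 * length Ps \<le> s * L * d\<^sup>2" for s
      using family_inequality[OF sub size 3 that(1,2)] that(3) by simp
    then have reg: "L * d ^ 3 \<le> 92160 * length Ps \<or> L ^ 4 * d ^ 6 \<le> 884736 * length Ps ^ 3"
      by (intro two_regimes[OF 3 pos(2)])
    have dn: "real m / (16 * n) \<le> real d"
      using div_ge_half[of m "8 * card V"] 3(1) unfolding d_def n_def by simp
    have Lp: "real m / (64 * p) \<le> real L"
      using div_ge_half[of m "32 * length Ps"] 3(2) unfolding L_def p_def by simp
    have nn: "0 \<le> real m / (16 * n)" "0 \<le> real m / (64 * p)"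
      using np by auto
    from reg show ?thesis
    proof
      assume "L * d ^ 3 \<le> 92160 * length Ps"
      then have "real (L * d ^ 3) \<le> real (92160 * length Ps)"
        by (simp only: of_nat_le_iff)
      then have "real L * real d ^ 3 \<le> 92160 * p"
        by (simp add: p_def)
      moreover have "(real m / (64 * p)) * (real m / (16 * n)) ^ 3 \<le> real L * real d ^ 3"
        using dn Lp nn by (intro mult_mono power_mono) auto
      ultimately have "(real m / (64 * p)) * (real m / (16 * n)) ^ 3 \<le> 92160 * p"
        by linarith
      \<comment> \<open>The constant is 92160 * 64 * 16^3, which is below 1000^4.\<close>
      then have "real m ^ 4 \<le> 24159191040 * (n ^ 3 * p ^ 2)"
        using np by (simp add: field_simps power2_eq_square power3_eq_cube power4_eq_xxxx)
      also have "\<dots> \<le> 1000 ^ 4 * (n ^ 3 * p ^ 2)"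
        using np by (intro mult_right_mono) auto
      also have "\<dots> = (1000 * (n powr (3/4) * p powr (1/2))) ^ 4"
        using np by (simp add: power_mult_distrib powr_power)
      finally have "real m \<le> 1000 * (n powr (3/4) * p powr (1/2))"
        by (rule power_le_imp_le_base[of _ 3, simplified]) auto
      then show ?thesis
        using pw np by argo
    next
      assume "L ^ 4 * d ^ 6 \<le> 884736 * length Ps ^ 3"
      then have "real (L ^ 4 * d ^ 6) \<le> real (884736 * length Ps ^ 3)"
        by (simp only: of_nat_le_iff)
      then have "real L ^ 4 * real d ^ 6 \<le> 884736 * p ^ 3"
        by (simp add: p_def)
      moreover have "(real m / (64 * p)) ^ 4 * (real m / (16 * n)) ^ 6 \<le> real L ^ 4 * real d ^ 6"
        using dn Lp nn by (intro mult_mono power_mono) auto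
      ultimately have "(real m / (64 * p)) ^ 4 * (real m / (16 * n)) ^ 6 \<le> 884736 * p ^ 3"
        by linarith
      moreover have "(real m / (64 * p)) ^ 4 * (real m / (16 * n)) ^ 6 = real m ^ 10 / (64 ^ 4 * 16 ^ 6 * (p ^ 4 * n ^ 6))"
        by (simp add: power_divide power_mult_distrib flip: power_add)
      ultimately have "real m ^ 10 \<le> 884736 * p ^ 3 * (64 ^ 4 * 16 ^ 6 * (p ^ 4 * n ^ 6))"
        using np by (simp only: pos_divide_le_eq zero_less_mult_iff zero_less_power zero_less_numeral simp_thms)
      also have "\<dots> = (884736 * 64 ^ 4 * 16 ^ 6) * (n ^ 6 * p ^ 7)"
        by (simp add: mult_ac flip: power_add)
      also have "\<dots> \<le> 1000 ^ 10 * (n ^ 6 * p ^ 7)"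
        using np by (intro mult_right_mono) auto
      also have "\<dots> = (1000 * (n powr (3/5) * p powr (7/10))) ^ 10"
        using np by (simp add: power_mult_distrib powr_power)
      finally have "real m \<le> 1000 * (n powr (3/5) * p powr (7/10))"
        by (rule power_le_imp_le_base[of _ 9, simplified]) auto
      then show ?thesis
        using powr_mix_le[OF np] pw np by argo
    qed
  qed
  then show ?thesis
    by (simp add: m_def)
qed

theorem theorem3p4:
  shows "\<exists>C>0. \<forall>n p. n > 0 \<longrightarrow> p > 0 \<longrightarrow>
    real (beta n p 4) \<le> C * (real n powr (3/4) * real p powr (1/2)
       + real n powr (5/8) * real p powr (11/16) + real n + real p)"
proof (intro exI[of _ 1000] conjI allI impI)
  fix n p :: nat assume np: "n > 0" "p > 0"
  obtain V :: "nat set" and Ps where "path_system V Ps" "card V = n" "length Ps = p"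
    "enat 4 < bridge_girth Ps" "beta n p 4 = ps_size Ps"
    using beta_attained[OF np(1), of p 4] by blast
  then show "real (beta n p 4) \<le> 1000 * (real n powr (3/4) * real p powr (1/2)
       + real n powr (5/8) * real p powr (11/16) + real n + real p)"
    using path_system_size_le[of V Ps] np by simp
qed simp

end
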